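(* Let $\Gamma=\mathrm{PSL}_2(\mathbb{Z})$, let $S$ be the image of $\begin{pmatrix}0&-1\\1&0\end{pmatrix}$, $T$ the image of $\begin{pmatrix}1&1\\0&1\end{pmatrix}$ and $R=ST$, so that $\Gamma$ is the free product of the cyclic groups $\langle S\rangle$ of order $2$ and $\langle R\rangle$ of order $3$. Let $\phi_1,\phi_2,\phi_3,\phi_4\colon\Gamma\to S_7$ be the homomorphisms determined by $\phi_1(S)=(12)(34)(56)$, $\phi_1(R)=(235)(467)$; $\phi_2(S)=(12)(34)(56)$, $\phi_2(R)=(235)(764)$; $\phi_3(S)=(12)(34)(67)$, $\phi_3(R)=(235)(467)$; $\phi_4(S)=(12)(34)(67)$, $\phi_4(R)=(253)(467)$. For $j=1,\dots,7$ let $G_j=\phi_1^{-1}(\mathrm{Stab}(j))$, $H_j=\phi_2^{-1}(\mathrm{Stab}(j))$, $U_j=\phi_3^{-1}(\mathrm{Stab}(j))$, $V_j=\phi_4^{-1}(\mathrm{Stab}(j))$, where $\mathrm{Stab}(j)$ is the stabilizer of $j$ in the image of the respective homomorphism. Then every subgroup of $\Gamma$ of index less than $7$ is a congruence subgroup, and the noncongruence subgroups of $\Gamma$ of index $7$ are exactly the groups $G_j,H_j,U_j,V_j$ for $j=1,\dots,7$ (in particular, each of these groups is noncongruence).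
   Context: Permutations in $S_7$ are composed as functions, right to left. A subgroup of $\Gamma$ is congruence if it contains the image of some principal congruence subgroup $\Gamma(N)$, and noncongruence otherwise. *)

theory Defs
  imports
    "HOL-Analysis.Determinants"
    "HOL-Algebra.Sym_Groups"
    "HOL-Algebra.Group_Action"
    "HOL-Number_Theory.Cong"
begin

definition mat2 :: "int \<Rightarrow> int \<Rightarrow> int \<Rightarrow> int \<Rightarrow> int^2^2" where
  "mat2 a b c d = vector [vector [a, b], vector [c, d]]"

definition SL2Z :: "(int^2^2) monoid" where
  "SL2Z = \<lparr>carrier = {A. det A = 1}, mult = (**), one = mat 1\<rparr>"

definition PSL2Z :: "(int^2^2) set monoid" where
  "PSL2Z = SL2Z Mod {mat 1, - mat 1}"

definition to_PSL2Z :: "int^2^2 \<Rightarrow> (int^2^2) set" where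
  "to_PSL2Z A = {mat 1, - mat 1} #>\<^bsub>SL2Z\<^esub> A"

definition gen_S :: "(int^2^2) set" where
  "gen_S = to_PSL2Z (mat2 0 (-1) 1 0)"

definition gen_T :: "(int^2^2) set" where
  "gen_T = to_PSL2Z (mat2 1 1 0 1)"

definition gen_R :: "(int^2^2) set" where
  "gen_R = gen_S \<otimes>\<^bsub>PSL2Z\<^esub> gen_T"

definition principal_congruence :: "nat \<Rightarrow> (int^2^2) set" where
  "principal_congruence N =
     {A \<in> carrier SL2Z. \<forall>i j. [A $ i $ j = (mat 1 :: int^2^2) $ i $ j] (mod int N)}"

text \<open>The level must be positive: level \<open>0\<close> would give the trivial group, which is contained
  in every subgroup.\<close>

definition congruence_subgroup :: "(int^2^2) set set \<Rightarrow> bool" where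
  "congruence_subgroup H \<longleftrightarrow>
     subgroup H PSL2Z \<and> (\<exists>N\<ge>1. to_PSL2Z ` principal_congruence N \<subseteq> H)"

definition noncongruence_subgroup :: "(int^2^2) set set \<Rightarrow> bool" where
  "noncongruence_subgroup H \<longleftrightarrow> subgroup H PSL2Z \<and> \<not> congruence_subgroup H"

text \<open>The homomorphism with prescribed values at the two free generators. It is unique only as a
  function on the carrier, hence the restriction to extensional functions.\<close>

definition hom_determined_by ::
    "(nat \<Rightarrow> nat) \<Rightarrow> (nat \<Rightarrow> nat) \<Rightarrow> (int^2^2) set \<Rightarrow> nat \<Rightarrow> nat" where
  "hom_determined_by s r =
     (THE \<phi>. \<phi> \<in> hom PSL2Z (sym_group 7) \<and> \<phi> \<in> extensional (carrier PSL2Z) \<and>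
        \<phi> gen_S = s \<and> \<phi> gen_R = r)"

definition phi1 :: "(int^2^2) set \<Rightarrow> nat \<Rightarrow> nat" where
  "phi1 = hom_determined_by
     (cycle_of_list [1,2] \<circ> cycle_of_list [3,4] \<circ> cycle_of_list [5,6])
     (cycle_of_list [2,3,5] \<circ> cycle_of_list [4,6,7])"

definition phi2 :: "(int^2^2) set \<Rightarrow> nat \<Rightarrow> nat" where
  "phi2 = hom_determined_by
     (cycle_of_list [1,2] \<circ> cycle_of_list [3,4] \<circ> cycle_of_list [5,6])
     (cycle_of_list [2,3,5] \<circ> cycle_of_list [7,6,4])"

definition phi3 :: "(int^2^2) set \<Rightarrow> nat \<Rightarrow> nat" where
  "phi3 = hom_determined_by
     (cycle_of_list [1,2] \<circ> cycle_of_list [3,4] \<circ> cycle_of_list [6,7])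
     (cycle_of_list [2,3,5] \<circ> cycle_of_list [4,6,7])"

definition phi4 :: "(int^2^2) set \<Rightarrow> nat \<Rightarrow> nat" where
  "phi4 = hom_determined_by
     (cycle_of_list [1,2] \<circ> cycle_of_list [3,4] \<circ> cycle_of_list [6,7])
     (cycle_of_list [2,5,3] \<circ> cycle_of_list [4,6,7])"

definition stab_preimage :: "((int^2^2) set \<Rightarrow> nat \<Rightarrow> nat) \<Rightarrow> nat \<Rightarrow> (int^2^2) set set" where
  "stab_preimage \<phi> j =
     {g \<in> carrier PSL2Z.
        \<phi> g \<in> stabilizer ((sym_group 7)\<lparr>carrier := \<phi> ` carrier PSL2Z\<rparr>) (\<lambda>p. p) j}"

end

theory Submission
  imports Defs
begin

text \<open>
  Subgroups of index \<open>n\<close> in \<open>\<Gamma>\<close> are the point stabilizers of transitive actions of \<open>\<Gamma>\<close> on \<open>n\<close> points,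
  and since \<open>\<Gamma>\<close> is the free product of \<open>\<langle>S\<rangle>\<close> and \<open>\<langle>R\<rangle>\<close>, such an action is a transitive pair of
  permutations \<open>(s, r)\<close> with \<open>s\<^sup>2 = r\<^sup>3 = 1\<close>. A coset enumeration shows that for \<open>n \<le> 7\<close> there are 21
  of them up to isomorphism. For 17 of them the point \<open>A \<cdot> 1\<close> depends only on \<open>A\<close> modulo some \<open>N\<close>,
  which is checked by saturating the set of pairs \<open>(A mod N, A \<cdot> 1)\<close> under \<open>S\<close> and \<open>R\<close>; their point
  stabilizers therefore contain \<open>\<Gamma>(N)\<close>. For the remaining four, all of degree 7, let \<open>m\<close> be the order
  of the permutation induced by \<open>T\<close>. By Wohlfahrt's theorem a congruence stabilizer would force \<open>\<Gamma>(m)\<close>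
  to act trivially, which is refuted by an explicit word in \<open>S\<close> and \<open>R\<close>.
\<close>

subsection \<open>The modular group as a free product\<close>

lemma mat2_nth [simp]:
  "mat2 a b c d $ 1 $ 1 = a" "mat2 a b c d $ 1 $ 2 = b"
  "mat2 a b c d $ 2 $ 1 = c" "mat2 a b c d $ 2 $ 2 = d"
  by (simp_all add: mat2_def)

lemma mat2_eq_iff [simp]:
  "mat2 a b c d = mat2 a' b' c' d' \<longleftrightarrow> a = a' \<and> b = b' \<and> c = c' \<and> d = d'"
  by (metis mat2_nth)

lemma mat2_cases [cases type]:
  fixes A :: "int^2^2"
  obtains a b c d where "A = mat2 a b c d"
proof -
  have "A = mat2 (A $ 1 $ 1) (A $ 1 $ 2) (A $ 2 $ 1) (A $ 2 $ 2)"
    by (simp add: vec_eq_iff forall_2)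
  then show thesis by (rule that)
qed

lemma mat2_mult [simp]:
  "mat2 a b c d ** mat2 a' b' c' d' =
     mat2 (a * a' + b * c') (a * b' + b * d') (c * a' + d * c') (c * b' + d * d')"
  by (simp add: vec_eq_iff forall_2 matrix_matrix_mult_def sum_2)

lemma mat_1_eq_mat2: "mat 1 = mat2 1 0 0 1"
  by (simp add: vec_eq_iff forall_2 mat_def)

lemma uminus_mat2 [simp]: "- mat2 a b c d = mat2 (- a) (- b) (- c) (- d)"
  by (simp add: vec_eq_iff forall_2)

lemma det_mat2 [simp]: "det (mat2 a b c d) = a * d - b * c"
  by (simp add: det_2)

lemma SL2Z_simps [simp]:
  "A \<in> carrier SL2Z \<longleftrightarrow> det A = 1" "mult SL2Z = (**)" "one SL2Z = mat2 1 0 0 1"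
  by (simp_all add: SL2Z_def mat_1_eq_mat2)

lemma group_SL2Z: "group SL2Z"
proof (rule groupI)
  fix A assume A: "A \<in> carrier SL2Z"
  obtain a b c d where "A = mat2 a b c d" by (cases A)
  with A show "\<exists>B\<in>carrier SL2Z. B \<otimes>\<^bsub>SL2Z\<^esub> A = \<one>\<^bsub>SL2Z\<^esub>"
    by (intro bexI[of _ "mat2 d (- b) (- c) a"]) (auto simp: algebra_simps)
next
  fix A assume "A \<in> carrier SL2Z"
  show "\<one>\<^bsub>SL2Z\<^esub> \<otimes>\<^bsub>SL2Z\<^esub> A = A" by (cases A) auto
qed (auto simp: det_mul matrix_mul_assoc)

interpretation SL: group SL2Z by (rule group_SL2Z)

lemma inv_SL2Z_mat2:
  assumes "a * d - b * c = 1"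
  shows "inv\<^bsub>SL2Z\<^esub> (mat2 a b c d) = mat2 d (- b) (- c) a"
  using assms by (intro SL.inv_equality) (auto simp: algebra_simps)

lemma uminus_mult_mat2: "(- A) ** B = - (A ** B)" "A ** (- B) = - (A ** B)" for A B :: "int^2^2"
  by (cases A; cases B; simp add: algebra_simps)+

lemma normal_center: "{mat 1, - mat 1} \<lhd> SL2Z"
proof -
  have "subgroup {mat 1, - mat 1} SL2Z"
    by (rule SL.subgroupI) (auto simp: mat_1_eq_mat2 inv_SL2Z_mat2)
  moreover have "A \<otimes>\<^bsub>SL2Z\<^esub> h \<otimes>\<^bsub>SL2Z\<^esub> inv\<^bsub>SL2Z\<^esub> A \<in> {mat 1, - mat 1}"
    if "A \<in> carrier SL2Z" "h \<in> {mat 1, - mat 1}" for A h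
  proof -
    have "A ** inv\<^bsub>SL2Z\<^esub> A = mat 1"
      using SL.r_inv[OF that(1)] by (simp add: mat_1_eq_mat2)
    then show ?thesis
      using that(2) by (auto simp: uminus_mult_mat2)
  qed
  ultimately show ?thesis
    by (simp add: SL.normal_inv_iff)
qed

lemma group_PSL2Z: "group PSL2Z"
  unfolding PSL2Z_def by (rule normal.factorgroup_is_group[OF normal_center])

interpretation PSL: group PSL2Z by (rule group_PSL2Z)

lemma to_PSL2Z_eq: "to_PSL2Z A = {A, - A}"
  by (auto simp: to_PSL2Z_def r_coset_def uminus_mult_mat2)

lemma to_PSL2Z_eq_iff: "to_PSL2Z A = to_PSL2Z B \<longleftrightarrow> A = B \<or> A = - B"
  by (auto simp: to_PSL2Z_eq doubleton_eq_iff)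

lemma to_PSL2Z_hom: "to_PSL2Z \<in> hom SL2Z PSL2Z"
  using normal.r_coset_hom_Mod[OF normal_center]
  unfolding PSL2Z_def to_PSL2Z_def .

interpretation PSL_hom: group_hom SL2Z PSL2Z to_PSL2Z
  by (unfold_locales) (rule to_PSL2Z_hom)

lemma carrier_PSL2Z: "carrier PSL2Z = to_PSL2Z ` carrier SL2Z"
  by (auto simp: PSL2Z_def FactGroup_def RCOSETS_def to_PSL2Z_def)

text \<open>Lifts of \<open>gen_S\<close> and \<open>gen_R\<close>. In \<open>SL2Z\<close> both S^2
  and R^3 equal -1, so the orders there are 4 and 6.\<close>

definition mat_S :: "int^2^2" where "mat_S = mat2 0 (-1) 1 0"
definition mat_R :: "int^2^2" where "mat_R = mat2 0 (-1) 1 1"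

lemma det_mat_S [simp]: "det mat_S = 1" and det_mat_R [simp]: "det mat_R = 1"
  by (simp_all add: mat_S_def mat_R_def)

lemma mat_S_closed: "mat_S \<in> carrier SL2Z" and mat_R_closed: "mat_R \<in> carrier SL2Z"
  by simp_all

lemma gen_S_eq: "gen_S = to_PSL2Z mat_S"
  by (simp add: gen_S_def mat_S_def)

lemma gen_R_eq: "gen_R = to_PSL2Z mat_R"
  using PSL_hom.hom_mult[of "mat2 0 (-1) 1 0" "mat2 1 1 0 1"]
  by (simp add: gen_R_def gen_S_def gen_T_def mat_R_def)

lemma gen_closed [simp]: "gen_S \<in> carrier PSL2Z" "gen_R \<in> carrier PSL2Z"
  unfolding gen_S_eq gen_R_eq by (rule PSL_hom.hom_closed, simp)+

lemma one_PSL2Z: "\<one>\<^bsub>PSL2Z\<^esub> = to_PSL2Z (mat2 1 0 0 1)"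
  using PSL_hom.hom_one by simp

lemma gen_S_square: "gen_S \<otimes>\<^bsub>PSL2Z\<^esub> gen_S = \<one>\<^bsub>PSL2Z\<^esub>"
  unfolding gen_S_eq one_PSL2Z PSL_hom.hom_mult[OF mat_S_closed mat_S_closed, symmetric]
  by (simp add: mat_S_def to_PSL2Z_eq_iff)

lemma gen_R_cube: "gen_R \<otimes>\<^bsub>PSL2Z\<^esub> (gen_R \<otimes>\<^bsub>PSL2Z\<^esub> gen_R) = \<one>\<^bsub>PSL2Z\<^esub>"
  unfolding gen_R_eq one_PSL2Z PSL_hom.hom_mult[OF mat_R_closed mat_R_closed, symmetric]
    PSL_hom.hom_mult[OF mat_R_closed SL.m_closed[OF mat_R_closed mat_R_closed], symmetric]
  by (simp add: mat_R_def to_PSL2Z_eq_iff)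

text \<open>In words, \<open>True\<close> stands for \<open>s\<close> and \<open>False\<close> for \<open>r\<close>.\<close>

primrec wprod :: "('a, 'b) monoid_scheme \<Rightarrow> 'a \<Rightarrow> 'a \<Rightarrow> bool list \<Rightarrow> 'a" where
  "wprod G s r [] = \<one>\<^bsub>G\<^esub>"
| "wprod G s r (g # w) = (if g then s else r) \<otimes>\<^bsub>G\<^esub> wprod G s r w"

lemma (in monoid) wprod_closed [simp, intro]:
  assumes "s \<in> carrier G" "r \<in> carrier G"
  shows "wprod G s r w \<in> carrier G"
  using assms by (induction w) auto

lemma (in monoid) wprod_append:
  assumes "s \<in> carrier G" "r \<in> carrier G"
  shows "wprod G s r (v @ w) = wprod G s r v \<otimes> wprod G s r w"
  using assms by (induction v) (auto simp: m_assoc)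

lemma (in group_hom) hom_wprod:
  assumes "s \<in> carrier G" "r \<in> carrier G"
  shows "h (wprod G s r w) = wprod H (h s) (h r) w"
  using assms by (induction w) auto

section \<open>Generation by S and R\<close>

abbreviation word_mat :: "bool list \<Rightarrow> int^2^2" where
  "word_mat \<equiv> wprod SL2Z mat_S mat_R"

abbreviation word_PSL :: "bool list \<Rightarrow> (int^2^2) set" where
  "word_PSL \<equiv> wprod PSL2Z gen_S gen_R"

lemma word_mat_closed: "word_mat w \<in> carrier SL2Z"
  by (rule SL.wprod_closed) simp_all

lemma to_PSL2Z_word_mat: "to_PSL2Z (word_mat w) = word_PSL w"
  by (simp add: PSL_hom.hom_wprod gen_S_eq gen_R_eq)

text \<open>Euclidean algorithm on the first column: for q = \<open>a div c\<close> the matrix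
  \<open>B\<close> = S T^(-q) A has lower left entry \<open>a mod c\<close>, smaller than c in
  absolute value. At c = 0 only the matrices \<plusminus>T^k are left.\<close>

lemma range_word_mat: "A \<in> carrier SL2Z \<Longrightarrow> A \<in> range word_mat"
proof (induction "nat \<bar>A $ 2 $ 1\<bar>" arbitrary: A rule: less_induct)
  case less
  have mult: "A ** B \<in> range word_mat" if "A \<in> range word_mat" "B \<in> range word_mat" for A B
  proof -
    from that obtain v w where "A = word_mat v" "B = word_mat w" by blast
    then have "A ** B = word_mat (v @ w)" by (simp add: SL.wprod_append)
    then show ?thesis by simp
  qed
  have word: "word_mat w \<in> range word_mat" for w by simp
  \<comment> \<open>From R = ST come T = S^(-1) R and T^(-1) = R^(-1) S; words spell the inverses as
    S^3 and R^5.\<close>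
  have neg: "mat2 (-1) 0 0 (-1) \<in> range word_mat"
    using word[of "[True, True]"] by (simp add: mat_S_def)
  have S_inv: "mat2 0 1 (-1) 0 \<in> range word_mat"
    using word[of "[True, True, True]"] by (simp add: mat_S_def)
  have T1: "mat2 1 1 0 1 \<in> range word_mat"
    using word[of "[True, True, True, False]"] by (simp add: mat_S_def mat_R_def)
  have T2: "mat2 1 (-1) 0 1 \<in> range word_mat"
    using word[of "[False, False, False, False, False, True]"] by (simp add: mat_S_def mat_R_def)
  have T: "mat2 1 k 0 1 \<in> range word_mat" for k
  proof (induction k rule: int_induct[where k = 0])
    case base
    show ?case using word[of "[]"] by simp
  next
    case (step1 i)
    then show ?case using mult[OF T1 step1(2)] by simp
  next
    case (step2 i)
    then show ?case using mult[OF T2 step2(2)] by simp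
  qed
  obtain a b c d where A: "A = mat2 a b c d" by (cases A)
  with less.prems have det: "a * d - b * c = 1" by simp
  show ?case
  proof (cases "c = 0")
    case True
    with det have "a = 1 \<and> d = 1 \<or> a = -1 \<and> d = -1"
      using zmult_eq_1_iff by auto
    then show ?thesis
      using T[of b] mult[OF neg T[of "- b"]] A True by auto
  next
    case False
    define B where "B = mat2 (- c) (- d) (a mod c) (b - a div c * d)"
    have eq: "a mod c = a - a div c * c"
      by (simp add: minus_div_mult_eq_mod)
    have "nat \<bar>a mod c\<bar> < nat \<bar>c\<bar>"
      using False by (simp add: abs_mod_less)
    moreover have "B \<in> carrier SL2Z"
      using det by (simp add: B_def eq algebra_simps)
    ultimately have "B \<in> range word_mat"
      using less.hyps[of B] by (simp add: A B_def)
    moreover have "A = mat2 1 (a div c) 0 1 ** (mat2 0 1 (-1) 0 ** B)"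
      by (simp add: A B_def eq)
    ultimately show ?thesis
      using mult[OF T mult[OF S_inv]] by simp
  qed
qed

lemma carrier_PSL2Z_eq_range: "carrier PSL2Z = range word_PSL"
  using range_word_mat word_mat_closed
  unfolding carrier_PSL2Z to_PSL2Z_word_mat[symmetric] by (force simp del: SL2Z_simps)

text \<open>The exponents \<open>3 = 4 - 1\<close> and \<open>5 = 6 - 1\<close> are the ones that invert already in \<open>SL\<^sub>2(\<int>)\<close>.\<close>

definition word_inv :: "bool list \<Rightarrow> bool list" where
  "word_inv w = concat (map (\<lambda>g. if g then replicate 3 True else replicate 5 False) (rev w))"

lemma word_inv_simps [simp]:
  "word_inv [] = []" "word_inv (g # w) = word_inv w @ (if g then replicate 3 True else replicate 5 False)"
  by (simp_all add: word_inv_def)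

lemma word_mat_word_inv: "word_mat (word_inv w) = inv\<^bsub>SL2Z\<^esub> (word_mat w)"
proof (induction w)
  case Nil
  show ?case using SL.inv_one by simp
next
  case (Cons g w)
  have "inv\<^bsub>SL2Z\<^esub> mat_S = word_mat (replicate 3 True)" "inv\<^bsub>SL2Z\<^esub> mat_R = word_mat (replicate 5 False)"
    by (simp_all add: numeral_eq_Suc mat_S_def mat_R_def inv_SL2Z_mat2)
  then show ?case
    using Cons SL.inv_mult_group[of "if g then mat_S else mat_R" "word_mat w"] word_mat_closed[of w]
    by (auto simp: SL.wprod_append)
qed

locale modular_pair = group +
  fixes s r
  assumes s_closed [simp]: "s \<in> carrier G" and r_closed [simp]: "r \<in> carrier G"
    and s_square: "s \<otimes> s = \<one>" and r_cube: "r \<otimes> (r \<otimes> r) = \<one>"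
begin

lemma s_s_cancel [simp]: "x \<in> carrier G \<Longrightarrow> s \<otimes> (s \<otimes> x) = x"
  by (simp add: m_assoc[symmetric] s_square)

lemma r_r_r_cancel [simp]: "x \<in> carrier G \<Longrightarrow> r \<otimes> (r \<otimes> (r \<otimes> x)) = x"
  by (metis m_assoc m_closed l_one r_closed r_cube)

lemma wprod_word_inv: "wprod G s r (word_inv w) = inv (wprod G s r w)"
proof (induction w)
  case (Cons g w)
  have "inv s = wprod G s r (replicate 3 True)"
    by (rule inv_equality) (simp_all add: numeral_eq_Suc m_assoc s_square)
  moreover have "inv r = wprod G s r (replicate 5 False)"
    by (rule inv_equality) (simp_all add: numeral_eq_Suc m_assoc r_cube)
  ultimately show ?case
    using Cons by (simp add: wprod_append inv_mult_group)
qed simp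

end

interpretation PSL: modular_pair PSL2Z gen_S gen_R
  by unfold_locales (simp_all add: gen_S_square gen_R_cube)

text \<open>
  Every element of a group generated by \<open>s\<close> and \<open>r\<close> with \<open>s\<^sup>2 = r\<^sup>3 = 1\<close> can be written as
  \<open>r\<^sup>a p s\<^sup>b\<close> with \<open>p\<close> a product of factors \<open>s r\<close> (coded \<open>True\<close>) and \<open>s r\<^sup>2\<close> (coded \<open>False\<close>). In
  \<open>PSL\<^sub>2(\<int>)\<close> these factors are the upper and the lower elementary matrix, so \<open>p\<close> is non-negative,
  and this makes the expression unique.
\<close>

fun s_step :: "nat \<times> bool list \<times> bool \<Rightarrow> nat \<times> bool list \<times> bool" where
  "s_step (Suc a, u, b) = (0, (a = 0) # u, b)"
| "s_step (0, [], b) = (0, [], \<not> b)"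
| "s_step (0, g # u, b) = (if g then 1 else 2, u, b)"

fun r_step :: "nat \<times> bool list \<times> bool \<Rightarrow> nat \<times> bool list \<times> bool" where
  "r_step (a, u, b) = (if a = 2 then 0 else Suc a, u, b)"

definition nform :: "bool list \<Rightarrow> nat \<times> bool list \<times> bool" where
  "nform w = foldr (\<lambda>g. if g then s_step else r_step) w (0, [], False)"

lemma nform_simps [simp]:
  "nform [] = (0, [], False)" "nform (g # w) = (if g then s_step else r_step) (nform w)"
  by (simp_all add: nform_def)

lemma fst_nform: "fst (nform w) \<le> 2"
proof (induction w)
  case (Cons g w)
  then show ?case
    by (cases "nform w" rule: s_step.cases) auto
qed simp

fun letters :: "nat \<times> bool list \<times> bool \<Rightarrow> bool list" where
  "letters (a, u, b) =
     replicate a False @ concat (map (\<lambda>g. if g then [True, False] else [True, False, False]) u)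
       @ (if b then [True] else [])"

text \<open>The steps are left multiplication by s and r on r^a p s^b. The bound a \<le> 2 matters:
  \<open>s_step\<close> reads every exponent beyond 1 as 2.\<close>

lemma (in modular_pair) wprod_nform: "wprod G s r (letters (nform w)) = wprod G s r w"
proof (induction w)
  case (Cons g w)
  show ?case
  proof (cases g)
    case True
    have "wprod G s r (letters (s_step x)) = s \<otimes> wprod G s r (letters x)" if "fst x \<le> 2" for x
      using that
    proof (cases x rule: s_step.cases)
      case (1 a u b)
      with that have "a = 0 \<or> a = 1" by auto
      with 1 show ?thesis by auto
    qed (auto simp: numeral_2_eq_2 s_square)
    with True Cons fst_nform show ?thesis by simp
  next
    case False
    have "wprod G s r (letters (r_step x)) = r \<otimes> wprod G s r (letters x)" if "fst x \<le> 2" for x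
    proof -
      obtain a u b where "x = (a, u, b)" by (cases x)
      moreover from this that have "a = 0 \<or> a = 1 \<or> a = 2" by auto
      ultimately show ?thesis by (auto simp: numeral_2_eq_2)
    qed
    with False Cons fst_nform show ?thesis by simp
  qed
qed simp

fun pos_mat :: "bool list \<Rightarrow> int^2^2" where
  "pos_mat [] = mat2 1 0 0 1"
| "pos_mat (g # u) = (if g then mat2 1 1 0 1 else mat2 1 0 1 1) ** pos_mat u"

text \<open>Each factor preserves nonnegativity, and a d = 1 + b c then makes a and d positive. So
  the newest factor leaves a positive entry off the diagonal, b + d or a + c, which keeps nonempty
  products away from 1.\<close>

lemma pos_mat_nonneg:
  obtains a b c d where "pos_mat u = mat2 a b c d" "0 \<le> a" "0 \<le> b" "0 \<le> c" "0 \<le> d"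
    "a * d - b * c = 1" "u = [] \<or> 1 \<le> b \<or> 1 \<le> c"
proof (induction u arbitrary: thesis)
  case (Cons g u)
  obtain a b c d where *: "pos_mat u = mat2 a b c d" "0 \<le> a" "0 \<le> b" "0 \<le> c" "0 \<le> d"
    "a * d - b * c = 1"
    by (rule Cons.IH)
  have "0 \<le> b * c" using * by simp
  with *(6) have "a \<noteq> 0" "d \<noteq> 0" by auto
  with * have "1 \<le> a" "1 \<le> d" by simp_all
  show ?case
  proof (cases g)
    case True
    with * \<open>1 \<le> d\<close> show ?thesis
      by (intro Cons.prems[of "a + c" "b + d" c d]) (simp_all add: algebra_simps)
  next
    case False
    with * \<open>1 \<le> a\<close> show ?thesis
      by (intro Cons.prems[of a b "a + c" "b + d"]) (simp_all add: algebra_simps)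
  qed
qed simp

text \<open>S R and S R^2 are the negatives of the two elementary matrices, so the identification
  takes place in \<open>PSL2Z\<close>, where signs vanish.\<close>

lemma word_PSL_letters:
  "word_PSL (letters (a, u, b)) =
     to_PSL2Z (word_mat (replicate a False) ** pos_mat u ** (if b then mat_S else mat2 1 0 0 1))"
proof -
  have u: "word_PSL (concat (map (\<lambda>g. if g then [True, False] else [True, False, False]) u)) =
      to_PSL2Z (pos_mat u) \<and> pos_mat u \<in> carrier SL2Z"
  proof (induction u)
    case Nil
    then show ?case by (simp add: one_PSL2Z)
  next
    case (Cons g u)
    have T: "word_PSL [True, False] = to_PSL2Z (mat2 1 1 0 1)"
      unfolding to_PSL2Z_word_mat[symmetric] by (simp add: mat_S_def mat_R_def to_PSL2Z_eq_iff)
    have L: "word_PSL [True, False, False] = to_PSL2Z (mat2 1 0 1 1)"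
      unfolding to_PSL2Z_word_mat[symmetric] by (simp add: mat_S_def mat_R_def to_PSL2Z_eq_iff)
    have "word_PSL ((if g then [True, False] else [True, False, False]) @
        concat (map (\<lambda>g. if g then [True, False] else [True, False, False]) u)) =
      to_PSL2Z (if g then mat2 1 1 0 1 else mat2 1 0 1 1) \<otimes>\<^bsub>PSL2Z\<^esub> to_PSL2Z (pos_mat u)"
      unfolding PSL.wprod_append[OF gen_closed] conjunct1[OF Cons] using T L by simp
    also have "\<dots> = to_PSL2Z (pos_mat (g # u))"
      using Cons PSL_hom.hom_mult[of "if g then mat2 1 1 0 1 else mat2 1 0 1 1" "pos_mat u"] by simp
    finally show ?case
      using Cons by (auto simp: det_mul)
  qed
  have b: "word_PSL (if b then [True] else []) = to_PSL2Z (if b then mat_S else mat2 1 0 0 1)"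
    by (simp add: gen_S_eq[symmetric] one_PSL2Z[symmetric])
  have b': "(if b then mat_S else mat2 1 0 0 1) \<in> carrier SL2Z"
    by (simp add: mat_S_def)
  have "word_PSL (letters (a, u, b)) = to_PSL2Z (word_mat (replicate a False)) \<otimes>\<^bsub>PSL2Z\<^esub>
     (to_PSL2Z (pos_mat u) \<otimes>\<^bsub>PSL2Z\<^esub> to_PSL2Z (if b then mat_S else mat2 1 0 0 1))"
    unfolding letters.simps PSL.wprod_append[OF gen_closed] using u b
    by (simp only: to_PSL2Z_word_mat)
  also have "\<dots> = to_PSL2Z (word_mat (replicate a False) **
     (pos_mat u ** (if b then mat_S else mat2 1 0 0 1)))"
    using PSL_hom.hom_mult[OF conjunct2[OF u] b']
      PSL_hom.hom_mult[OF word_mat_closed SL.m_closed[OF conjunct2[OF u] b'], of "replicate a False"]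
    by (simp only: SL2Z_simps(2))
  finally show ?thesis
    by (simp only: matrix_mul_assoc)
qed

text \<open>The heart of freeness. If R^a p S^b = \<plusminus>1, then p is up to sign one of the six
  matrices R^(-a) S^(-b). All of them except 1 have entries of both signs, while p is nonnegative,
  and p = 1 only for the empty product.\<close>

lemma nform_eq_triv:
  assumes "word_PSL w = \<one>\<^bsub>PSL2Z\<^esub>"
  shows "nform w = (0, [], False)"
proof -
  obtain a u b where n: "nform w = (a, u, b)" by (cases "nform w")
  have a: "a = 0 \<or> a = 1 \<or> a = 2"
    using fst_nform[of w] n by auto
  have "to_PSL2Z (word_mat (replicate a False) ** pos_mat u ** (if b then mat_S else mat2 1 0 0 1))
     = to_PSL2Z (mat2 1 0 0 1)"
    using assms PSL.wprod_nform[of w] by (simp add: n word_PSL_letters one_PSL2Z del: letters.simps)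
  moreover obtain p q p' q' where "pos_mat u = mat2 p q p' q'" "0 \<le> p" "0 \<le> q" "0 \<le> p'" "0 \<le> q'"
    "u = [] \<or> 1 \<le> q \<or> 1 \<le> p'"
    by (rule pos_mat_nonneg)
  ultimately show ?thesis
    using a unfolding n to_PSL2Z_eq_iff
    by (cases b) (auto simp: mat_S_def mat_R_def numeral_2_eq_2)
qed

section \<open>The universal property of the free product\<close>

context modular_pair
begin

text \<open>A relation v = w of \<open>PSL2Z\<close> makes the normal form of v^(-1) w trivial, and
  reduction to normal form uses only s^2 = r^3 = 1, which holds in \<open>G\<close> as well.\<close>

lemma wprod_cong:
  assumes "word_PSL v = word_PSL w"
  shows "wprod G s r v = wprod G s r w"
proof -
  have "word_PSL (word_inv v @ w) = \<one>\<^bsub>PSL2Z\<^esub>"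
    using assms by (simp add: PSL.wprod_append PSL.wprod_word_inv PSL.l_inv)
  then have "wprod G s r (word_inv v @ w) = \<one>"
    using wprod_nform[of "word_inv v @ w"] nform_eq_triv by simp
  then have "inv (wprod G s r v) \<otimes> wprod G s r w = \<one>"
    by (simp add: wprod_append wprod_word_inv)
  then show ?thesis
    by (metis inv_closed inv_equality inv_inv s_closed r_closed wprod_closed)
qed

text \<open>\<phi> evaluates a chosen word for its argument; \<open>wprod_cong\<close> makes the
  choice immaterial. The values on words are forced, and extensionality fixes those outside the
  carrier.\<close>

theorem ex1_hom_PSL2Z:
  "\<exists>!\<phi>. \<phi> \<in> hom PSL2Z G \<and> \<phi> \<in> extensional (carrier PSL2Z) \<and> \<phi> gen_S = s \<and> \<phi> gen_R = r"
proof -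
  have word: "\<phi> (word_PSL w) = wprod G s r w"
    if "\<phi> \<in> hom PSL2Z G" "\<phi> gen_S = s" "\<phi> gen_R = r" for \<phi> w
  proof -
    interpret group_hom PSL2Z G \<phi>
      by unfold_locales (rule that)
    show ?thesis using hom_wprod[OF gen_closed] that by simp
  qed
  define \<phi> where "\<phi> = (\<lambda>x \<in> carrier PSL2Z. wprod G s r (SOME w. x = word_PSL w))"
  have \<phi>: "\<phi> (word_PSL w) = wprod G s r w" for w
  proof -
    have "word_PSL w = word_PSL (SOME v. word_PSL w = word_PSL v)"
      by (rule someI[of "\<lambda>v. word_PSL w = word_PSL v" w]) simp
    from wprod_cong[OF this] show ?thesis
      by (simp add: \<phi>_def)
  qed
  have hom: "\<phi> \<in> hom PSL2Z G"
  proof (rule homI)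
    fix x y assume "x \<in> carrier PSL2Z" "y \<in> carrier PSL2Z"
    then obtain v w where "x = word_PSL v" "y = word_PSL w"
      by (auto simp only: carrier_PSL2Z_eq_range)
    then show "\<phi> (x \<otimes>\<^bsub>PSL2Z\<^esub> y) = \<phi> x \<otimes> \<phi> y"
      using \<phi>[of "v @ w"] by (simp only: \<phi> wprod_append PSL.wprod_append gen_closed s_closed r_closed)
  qed (auto simp only: carrier_PSL2Z_eq_range \<phi> wprod_closed s_closed r_closed)
  have gens: "\<phi> gen_S = s" "\<phi> gen_R = r"
    using \<phi>[of "[True]"] \<phi>[of "[False]"] by simp_all
  have ext: "\<phi> \<in> extensional (carrier PSL2Z)"
    by (simp add: \<phi>_def)
  have uniq: "\<psi> = \<phi>" if "\<psi> \<in> hom PSL2Z G" "\<psi> \<in> extensional (carrier PSL2Z)"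
    "\<psi> gen_S = s" "\<psi> gen_R = r" for \<psi>
  proof (rule extensionalityI[OF that(2)])
    show "\<phi> \<in> extensional (carrier PSL2Z)" by (rule ext)
    fix x assume "x \<in> carrier PSL2Z"
    then obtain w where "x = word_PSL w" by (auto simp only: carrier_PSL2Z_eq_range)
    then show "\<psi> x = \<phi> x" using word[OF that(1,3,4)] \<phi> by simp
  qed
  show ?thesis
    by (rule ex1I[of _ \<phi>], intro conjI hom ext gens, elim conjE, rule uniq)
qed

end

subsection \<open>Wohlfahrt's theorem\<close>

text \<open>Let k be the product of the primes that divide M but not a. A prime p dividing M then
  divides exactly one of a and k c: if p divides a, it divides neither k nor c; otherwise it divides
  k.\<close>

lemma exists_coprime_shift:
  fixes a c M :: int
  assumes "coprime a c" "M \<noteq> 0"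
  shows "\<exists>k. coprime (a + k * c) M"
proof -
  define P where "P = {p \<in> prime_factors M. \<not> p dvd a}"
  have fin: "finite P" by (simp add: P_def)
  have "coprime (a + \<Prod>P * c) M"
  proof (rule ccontr)
    assume "\<not> coprime (a + \<Prod>P * c) M"
    then have "gcd (a + \<Prod>P * c) M \<noteq> 1" by (simp add: coprime_iff_gcd_eq_1)
    moreover have "gcd (a + \<Prod>P * c) M \<noteq> 0" using assms(2) by simp
    ultimately obtain p where "prime p" "p dvd gcd (a + \<Prod>P * c) M"
      by (metis prime_divisor_exists is_unit_gcd coprime_iff_gcd_eq_1 \<open>\<not> coprime _ _\<close>)
    then have p: "prime p" "p dvd a + \<Prod>P * c" "p dvd M" by simp_all
    show False
    proof (cases "p dvd a")
      case True
      then have "p dvd \<Prod>P * c" using p(2) by (simp add: dvd_add_right_iff)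
      moreover have "\<not> p dvd c"
        using True p(1) assms(1) by (meson coprime_common_divisor not_prime_unit)
      ultimately have "p dvd \<Prod>P" using p(1) prime_dvd_mult_iff by blast
      then obtain q where "q \<in> P" "p dvd q"
        using prime_dvd_prod_iff[OF fin p(1), of "\<lambda>x. x"] by auto
      then have "p = q" using p(1) by (auto simp: P_def intro: primes_dvd_imp_eq)
      with \<open>q \<in> P\<close> True show False by (simp add: P_def)
    next
      case False
      with p assms(2) have "p \<in> P" by (simp add: P_def in_prime_factors_iff)
      then have "p dvd \<Prod>P" using fin by (rule dvd_prodI[of _ _ "\<lambda>x. x", rotated])
      then have "p dvd a" using p(2) by (meson dvd_add_left_iff dvd_mult2)
      with False show False ..
    qed
  qed
  then show ?thesis ..
qed

lemma mat2_in_principal_congruence: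
  "mat2 a b c d \<in> principal_congruence N \<longleftrightarrow>
     a * d - b * c = 1 \<and> int N dvd a - 1 \<and> int N dvd b \<and> int N dvd c \<and> int N dvd d - 1"
  by (auto simp: principal_congruence_def forall_2 mat_1_eq_mat2 cong_iff_dvd_diff)

lemma principal_congruence_conj:
  assumes "P \<in> carrier SL2Z" "A \<in> principal_congruence N"
  shows "inv\<^bsub>SL2Z\<^esub> P \<otimes>\<^bsub>SL2Z\<^esub> (A \<otimes>\<^bsub>SL2Z\<^esub> P) \<in> principal_congruence N"
proof -
  obtain p q u v where P: "P = mat2 p q u v" by (cases P)
  obtain a b c d where A: "A = mat2 a b c d" by (cases A)
  have det: "p * v - q * u = 1" using assms(1) P by simp
  have *: "int N dvd a - 1" "int N dvd b" "int N dvd c" "int N dvd d - 1"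
    using assms(2) by (simp_all add: A mat2_in_principal_congruence)
  have inv: "inv\<^bsub>SL2Z\<^esub> P = mat2 v (- q) (- u) p" using det by (simp add: P inv_SL2Z_mat2)
  have "inv\<^bsub>SL2Z\<^esub> P \<otimes>\<^bsub>SL2Z\<^esub> (A \<otimes>\<^bsub>SL2Z\<^esub> P) \<in> carrier SL2Z"
    using assms by (intro SL.m_closed SL.inv_closed) (simp_all add: principal_congruence_def)
  \<comment> \<open>Entries of P^(-1) A P - 1 = P^(-1) (A - 1) P, which are linear in the entries of
    A - 1, all divisible by N.\<close>
  moreover have "v * (a * p + b * u) - q * (c * p + d * u) - 1 =
      (a - 1) * (v * p) + b * (v * u) - c * (q * p) - (d - 1) * (q * u)"
    "v * (a * q + b * v) - q * (c * q + d * v) =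
      (a - 1) * (v * q) + b * (v * v) - c * (q * q) - (d - 1) * (q * v)"
    "p * (c * p + d * u) - u * (a * p + b * u) =
      c * (p * p) + (d - 1) * (p * u) - (a - 1) * (u * p) - b * (u * u)"
    "p * (c * q + d * v) - u * (a * q + b * v) - 1 =
      c * (p * q) + (d - 1) * (p * v) - (a - 1) * (u * q) - b * (u * v)"
    using det by (simp_all add: algebra_simps)
  then have "int N dvd v * (a * p + b * u) - q * (c * p + d * u) - 1"
    "int N dvd v * (a * q + b * v) - q * (c * q + d * v)"
    "int N dvd p * (c * p + d * u) - u * (a * p + b * u)"
    "int N dvd p * (c * q + d * v) - u * (a * q + b * v) - 1"
    using * by (simp_all only: dvd_add dvd_diff dvd_mult2)
  ultimately show ?thesis
    by (simp add: P A inv[unfolded P] mat2_in_principal_congruence)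
qed

text \<open>
  Modulo \<open>\<Gamma>(N)\<close>, every matrix of \<open>\<Gamma>(m)\<close> becomes a product of conjugates of powers of
  \<open>T\<^sup>m\<close>: it can be made diagonal by elementary operations of level \<open>m\<close>, and with
  \<open>L\<close> the transpose of \<open>T\<close>, \<open>diag(a, d) \<equiv> T T^(a-1) (L^(-d) T^(a-1) L^d) L^(1-d) T^(-1)\<close>.
\<close>

theorem wohlfahrt:
  assumes K: "K \<lhd> SL2Z" and T: "mat2 1 (int m) 0 1 \<in> K"
    and N: "N \<ge> 1" "principal_congruence N \<subseteq> K" and m: "m \<ge> 1"
  shows "principal_congruence m \<subseteq> K"
proof
  interpret K: normal K SL2Z by (rule K)
  \<comment> \<open>A common level: \<Gamma>(M) lies in \<Gamma>(N), hence in K, and m divides M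
    even where it does not divide N.\<close>
  define M where "M = N * m"
  have M: "int M = int N * int m" "int M \<noteq> 0" "int m dvd int M" using N(1) m by (simp_all add: M_def)
  have \<Gamma>: "B \<in> K" if "B \<in> principal_congruence M" for B
  proof -
    have "principal_congruence M \<subseteq> principal_congruence N"
    proof
      fix B assume "B \<in> principal_congruence M"
      then show "B \<in> principal_congruence N"
        by (cases B) (auto simp: mat2_in_principal_congruence M(1) intro: dvd_mult_left)
    qed
    with that N(2) show ?thesis by blast
  qed
  have mult: "A ** B \<in> K" if "A \<in> K" "B \<in> K" for A B
    using K.m_closed[OF that] by simp
  have conj: "mat2 p q u v ** (A ** mat2 v (- q) (- u) p) \<in> K" if "A \<in> K" "p * v - q * u = 1" for A p q u v
    using K.inv_op_closed2[of "mat2 p q u v" A] that by (simp add: inv_SL2Z_mat2 matrix_mul_assoc)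
  have U: "mat2 1 x 0 1 \<in> K" if "int m dvd x" for x
  proof -
    have "mat2 1 (int m * k) 0 1 \<in> K" for k
    proof (induction k rule: int_induct[where k = 0])
      case base
      show ?case using K.one_closed by simp
    next
      case (step1 i)
      show ?case using mult[OF T step1(2)] by (simp add: algebra_simps)
    next
      case (step2 i)
      have "mat2 1 (- int m) 0 1 \<in> K"
        using K.m_inv_closed[OF T] by (simp add: inv_SL2Z_mat2)
      from mult[OF this step2(2)] show ?case by (simp add: algebra_simps)
    qed
    with that show ?thesis by (auto elim: dvdE)
  qed
  \<comment> \<open>Conjugation by S turns T^(-x) into L^x.\<close>
  have L: "mat2 1 0 x 1 \<in> K" if "int m dvd x" for x
    using conj[OF U[of "- x"], of 0 0 "-1" 1] that by simp
  have diag: "mat2 a b c d \<in> K"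
    if "int M dvd b" "int M dvd c" "int m dvd a - 1" "int m dvd d - 1" "a * d - b * c = 1" for a b c d
  proof -
    \<comment> \<open>\<delta> = -(b c) is divisible by M. The matrix \<open>e\<close> is the
      product displayed before the theorem, multiplied out: it is diag(a, d) up to multiples of
      \<delta> and has determinant 1, so A e^(-1) lies in \<Gamma>(M).\<close>
    define \<delta> where "\<delta> = 1 - a * d"
    have \<delta>: "\<delta> = - (b * c)" using that(5) by (simp add: \<delta>_def)
    then have \<delta>M: "int M dvd \<delta>" using that(1) by simp
    have d1: "int m dvd 1 - d" using that(4) by (simp add: dvd_diff_commute)
    define e where "e = mat2 (a * (1 + \<delta>)) (- \<delta>) \<delta> d"
    have "mat2 1 (a - 1) 0 1 ** ((mat2 1 0 (- d) 1 ** (mat2 1 (a - 1) 0 1 ** mat2 1 (- 0) (- (- d)) 1))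
        ** mat2 1 0 (1 - d) 1) \<in> K"
      using mult[OF U[OF that(3)] mult[OF conj[OF U[OF that(3)], of 1 1 0 "- d"] L[OF d1]]] by simp
    from conj[OF this, of 1 1 1 0] have e: "e \<in> K"
      by (simp add: e_def \<delta>_def algebra_simps)
    have "mat2 a b c d ** mat2 d \<delta> (- \<delta>) (a * (1 + \<delta>)) \<in> principal_congruence M"
    proof -
      have "a * d - b * \<delta> - 1 = \<delta> * (- 1 - b)" "c * \<delta> + d * (a * (1 + \<delta>)) - 1 = \<delta> * (c - \<delta>)"
        by (simp_all add: \<delta>_def algebra_simps)
      then have "int M dvd a * d - b * \<delta> - 1" "int M dvd c * \<delta> + d * (a * (1 + \<delta>)) - 1"
        using \<delta>M by (simp_all only: dvd_mult2)
      moreover have "det (mat2 d \<delta> (- \<delta>) (a * (1 + \<delta>))) = 1"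
        by (simp add: \<delta>_def algebra_simps)
      then have "det (mat2 a b c d ** mat2 d \<delta> (- \<delta>) (a * (1 + \<delta>))) = 1"
        unfolding det_mul using that(5) by simp
      ultimately show ?thesis
        using \<delta>M that(1,2) by (simp add: mat2_in_principal_congruence)
    qed
    from mult[OF \<Gamma>[OF this] e] have "mat2 a b c d ** (mat2 d \<delta> (- \<delta>) (a * (1 + \<delta>)) ** e) \<in> K"
      by (simp only: matrix_mul_assoc)
    moreover have "mat2 d \<delta> (- \<delta>) (a * (1 + \<delta>)) ** e = mat2 1 0 0 1"
      by (simp add: e_def \<delta>_def algebra_simps)
    ultimately show ?thesis by simp
  qed
  \<comment> \<open>With b = m b' an inverse x of a modulo N suffices: k = -m b' x gives b + a k =
    -m b' (a x - 1), divisible by N m.\<close>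
  have solve: "\<exists>k. int m dvd k \<and> int M dvd b + a * k" if ab: "coprime a (int M)" "int m dvd b" for a b
  proof -
    obtain b' where b': "b = int m * b'" using ab(2) by (auto elim: dvdE)
    have "coprime a (int N)" using ab(1) by (simp add: M(1))
    then obtain x where "[a * x = 1] (mod int N)" using cong_solve_coprime_int by blast
    then obtain y where y: "a * x - 1 = int N * y" by (auto simp: cong_iff_dvd_diff elim: dvdE)
    have "b + a * (int m * (- b' * x)) = - (int m * b') * (a * x - 1)"
      by (simp add: b' algebra_simps)
    also have "\<dots> = int M * (- b' * y)" unfolding y M(1) by (simp add: algebra_simps)
    finally have "int M dvd b + a * (int m * (- b' * x))" by simp
    then show ?thesis using dvd_triv_left by blast
  qed
  have step: "mat2 a b c d \<in> K"
    if cop: "coprime a (int M)" "int m dvd a - 1" "int m dvd b" "int m dvd c" "int m dvd d - 1"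
      "a * d - b * c = 1" for a b c d
  proof -
    obtain k where k: "int m dvd k" "int M dvd b + a * k" using solve cop(1,3) by blast
    obtain l where l: "int m dvd l" "int M dvd c + a * l" using solve cop(1,4) by blast
    \<comment> \<open>This matrix is L^l A T^k, with both off-diagonal entries cleared modulo
      M.\<close>
    have "mat2 a (b + a * k) (c + a * l) (d + c * k + l * (b + a * k)) \<in> K"
    proof (rule diag[OF k(2) l(2) cop(2)])
      have "d + c * k + l * (b + a * k) - 1 = (d - 1) + c * k + l * (b + a * k)" by simp
      then show "int m dvd d + c * k + l * (b + a * k) - 1"
        using cop(5) k(1) l(1) by (metis dvd_add dvd_mult dvd_mult2)
      have "a * (d + c * k + l * (b + a * k)) - (b + a * k) * (c + a * l) = a * d - b * c"
        by (simp add: algebra_simps)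
      then show "a * (d + c * k + l * (b + a * k)) - (b + a * k) * (c + a * l) = 1"
        using cop(6) by simp
    qed
    from mult[OF mult[OF L[of "- l"] this] U[of "- k"]] show ?thesis
      using k(1) l(1) by (simp add: algebra_simps)
  qed
  fix A assume A: "A \<in> principal_congruence m"
  obtain a b c d where Aeq: "A = mat2 a b c d" by (cases A)
  with A have *: "int m dvd a - 1" "int m dvd b" "int m dvd c" "int m dvd d - 1" "a * d - b * c = 1"
    by (simp_all add: mat2_in_principal_congruence)
  have "coprime a (b * int m)"
  proof -
    have "coprime a b"
    proof (rule coprimeI)
      fix p assume "p dvd a" "p dvd b"
      then have "p dvd a * d - b * c" by simp
      then show "is_unit p" using *(5) by simp
    qed
    moreover have "coprime a (int m)"
    proof (rule coprimeI)
      fix p assume "p dvd a" "p dvd int m"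
      then have "p dvd a - (a - 1)" using *(1) by (metis dvd_diff dvd_trans)
      then show "is_unit p" by simp
    qed
    ultimately show ?thesis by simp
  qed
  \<comment> \<open>A L^(k m) has upper left entry a + k b m, so k can be chosen to make that entry
    a unit modulo M, as \<open>step\<close> requires.\<close>
  then obtain k where k: "coprime (a + k * (b * int m)) (int M)"
    using exists_coprime_shift M(2) by blast
  have "mat2 (a + k * (b * int m)) b (c + k * (d * int m)) d \<in> K"
  proof (rule step[OF k])
    have "a + k * (b * int m) - 1 = (a - 1) + k * (b * int m)" by simp
    then show "int m dvd a + k * (b * int m) - 1" using *(1) by (metis dvd_add dvd_mult dvd_triv_right)
    show "int m dvd c + k * (d * int m)" using *(3) by simp
  qed (use * in \<open>simp_all add: algebra_simps\<close>)
  from mult[OF this L[of "- (k * int m)"]] show "A \<in> K"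
    by (simp add: Aeq algebra_simps)
qed

subsection \<open>Transitive actions and point stabilizers\<close>

definition act :: "('x \<Rightarrow> 'x) \<Rightarrow> ('x \<Rightarrow> 'x) \<Rightarrow> bool list \<Rightarrow> 'x \<Rightarrow> 'x" where
  "act s r w x = foldr (\<lambda>g. if g then s else r) w x"

lemma act_simps [simp]:
  "act s r [] x = x" "act s r (g # w) x = (if g then s else r) (act s r w x)"
  by (simp_all add: act_def)

lemma act_append [simp]: "act s r (v @ w) x = act s r v (act s r w x)"
  by (simp add: act_def)

text \<open>All conditions are confined to X, so that table lookups on \<open>{1..n}\<close> and
  multiplications on cosets both fit.\<close>

locale modular_action =
  fixes X :: "'x set" and s r :: "'x \<Rightarrow> 'x" and x0 :: 'x
  assumes s_in: "x \<in> X \<Longrightarrow> s x \<in> X" and r_in: "x \<in> X \<Longrightarrow> r x \<in> X"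
    and s_s: "x \<in> X \<Longrightarrow> s (s x) = x" and r_r_r: "x \<in> X \<Longrightarrow> r (r (r x)) = x"
    and base_in: "x0 \<in> X" and transitive: "x \<in> X \<Longrightarrow> \<exists>w. act s r w x0 = x"
begin

lemma act_in: "x \<in> X \<Longrightarrow> act s r w x \<in> X"
  by (induction w) (auto simp: s_in r_in)

lemma eq_range_act: "X = range (\<lambda>w. act s r w x0)"
proof (intro equalityI subsetI)
  fix x assume "x \<in> X"
  then obtain w where "act s r w x0 = x" using transitive by blast
  then show "x \<in> range (\<lambda>w. act s r w x0)" by blast
qed (auto simp: act_in base_in)

lemma act_word_inv_left: "x \<in> X \<Longrightarrow> act s r (word_inv w) (act s r w x) = x"
proof (induction w)
  case (Cons g w)
  have "act s r (replicate 3 True) (s y) = y" "act s r (replicate 5 False) (r y) = y"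
    if "y \<in> X" for y
    using that by (simp_all add: numeral_eq_Suc s_s r_r_r s_in r_in)
  with Cons show ?case by (simp add: act_in)
qed simp

lemma act_word_inv_right: "x \<in> X \<Longrightarrow> act s r w (act s r (word_inv w) x) = x"
proof (induction w arbitrary: x)
  case (Cons g w)
  have "s (act s r (replicate 3 True) x) = x" "r (act s r (replicate 5 False) x) = x"
    using Cons.prems by (simp_all add: numeral_eq_Suc s_s r_r_r s_in r_in)
  with Cons show ?case by (simp add: act_in)
qed simp

text \<open>Equality of points becomes a question about the stabilizer of \<open>x0\<close>, which
  therefore determines the action.\<close>

lemma act_eq_iff: "act s r v x0 = act s r w x0 \<longleftrightarrow> act s r (word_inv v @ w) x0 = x0"
  by (metis act_append act_in act_word_inv_left act_word_inv_right base_in)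

lemma change_base:
  assumes "x1 \<in> X"
  shows "modular_action X s r x1"
proof
  fix x assume "x \<in> X"
  then obtain v w where "act s r v x0 = x" "act s r w x0 = x1"
    using transitive assms by blast
  then have "act s r (v @ word_inv w) x1 = x"
    using act_word_inv_left[OF base_in, of w] by simp
  then show "\<exists>w. act s r w x1 = x" ..
qed (use assms s_in r_in s_s r_r_r in auto)

text \<open>Since \<open>\<Gamma>(N)\<close> is normal, it fixes every point as soon as it fixes one.\<close>

lemma principal_congruence_acts_trivially:
  assumes fix0: "\<And>w. word_mat w \<in> principal_congruence N \<Longrightarrow> act s r w x0 = x0"
    and w: "word_mat w \<in> principal_congruence N" and x: "x \<in> X"
  shows "act s r w x = x"
proof -
  obtain v where v: "act s r v x0 = x" using transitive x by blast
  have "word_mat (word_inv v @ w @ v) \<in> principal_congruence N"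
    unfolding SL.wprod_append[OF mat_S_closed mat_R_closed] word_mat_word_inv
    by (rule principal_congruence_conj[OF word_mat_closed w])
  then have "act s r (word_inv v) (act s r w x) = x0" using fix0 v by fastforce
  then have "act s r v x0 = act s r w x"
    using act_word_inv_right[OF act_in[OF x], of v w] by simp
  with v show ?thesis by simp
qed

end

section \<open>Comparison of actions, and the action attached to a subgroup\<close>

lemma act_cong:
  assumes "\<And>x. x \<in> X \<Longrightarrow> s x \<in> X \<and> s' x = s x" "\<And>x. x \<in> X \<Longrightarrow> r x \<in> X \<and> r' x = r x" "x \<in> X"
  shows "act s' r' w x = act s r w x"
proof -
  have "act s' r' w x = act s r w x \<and> act s r w x \<in> X"
    using assms by (induction w) auto
  then show ?thesis ..
qed

text \<open>The bijection sends w x0 to w y0. It is well defined and injective because on both sides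
  equality of points reduces to the same stabilizer condition.\<close>

lemma card_eq_if_same_stabilizer:
  assumes "modular_action X s r x0" "modular_action Y s' r' y0"
    and stab: "\<And>w. act s r w x0 = x0 \<longleftrightarrow> act s' r' w y0 = y0"
  shows "card X = card Y"
proof -
  interpret X: modular_action X s r x0 by fact
  interpret Y: modular_action Y s' r' y0 by fact
  define f where "f x = act s' r' (SOME w. act s r w x0 = x) y0" for x
  have f: "f (act s r w x0) = act s' r' w y0" for w
  proof -
    have "act s r (SOME v. act s r v x0 = act s r w x0) x0 = act s r w x0"
      by (rule someI) simp
    then show ?thesis
      unfolding f_def X.act_eq_iff Y.act_eq_iff stab .
  qed
  have "bij_betw f X Y"
  proof (rule bij_betw_imageI)
    show "inj_on f X"
      by (auto simp: inj_on_def X.eq_range_act f X.act_eq_iff Y.act_eq_iff stab simp del: act_append)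
    show "f ` X = Y"
      unfolding X.eq_range_act Y.eq_range_act image_image f ..
  qed
  then show ?thesis by (rule bij_betw_same_card)
qed

text \<open>The stabilizer is described on words because \<open>s\<close> and \<open>r\<close> are
  merely maps; that words with equal value in \<open>PSL2Z\<close> act alike is derived in
  \<open>act_well_defined\<close>.\<close>

locale stabilizer_action = modular_action +
  fixes H
  assumes H_closed: "H \<subseteq> carrier PSL2Z"
    and word_in_H: "word_PSL w \<in> H \<longleftrightarrow> act s r w x0 = x0"
begin

lemma subgroup_H: "subgroup H PSL2Z"
proof (rule PSL.subgroupI[OF H_closed])
  show "H \<noteq> {}" using word_in_H[of "[]"] by auto
next
  fix g assume "g \<in> H"
  moreover from this obtain w where "g = word_PSL w"
    using H_closed by (auto simp only: carrier_PSL2Z_eq_range)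
  ultimately show "inv\<^bsub>PSL2Z\<^esub> g \<in> H"
    unfolding PSL.wprod_word_inv[symmetric]
    using act_word_inv_left[OF base_in, of w] by (simp add: word_in_H PSL.wprod_word_inv[symmetric])
next
  fix g h assume "g \<in> H" "h \<in> H"
  moreover from this obtain v w where "g = word_PSL v" "h = word_PSL w"
    using H_closed unfolding carrier_PSL2Z_eq_range by blast
  ultimately show "g \<otimes>\<^bsub>PSL2Z\<^esub> h \<in> H"
    by (simp add: word_in_H PSL.wprod_append[OF gen_closed, symmetric])
qed

text \<open>Writing x = u x0 moves the comparison to the base point, where (v u)^(-1) (w u) has
  value 1 and so lies in H.\<close>

lemma act_well_defined:
  assumes "word_PSL v = word_PSL w" "x \<in> X"
  shows "act s r v x = act s r w x"
proof -
  obtain u where u: "act s r u x0 = x"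
    using transitive assms(2) by blast
  have "word_PSL (word_inv (v @ u) @ w @ u) = \<one>\<^bsub>PSL2Z\<^esub>"
    using assms(1) by (simp add: PSL.wprod_append PSL.wprod_word_inv PSL.l_inv)
  then have "act s r (v @ u) x0 = act s r (w @ u) x0"
    unfolding act_eq_iff word_in_H[symmetric] using subgroup.one_closed[OF subgroup_H] by simp
  with u show ?thesis by simp
qed

text \<open>The repeated word S^3 R is T. The kernel K of the action, lifted to \<open>SL2Z\<close>,
  is normal and contains T^m; if H were congruence, K would contain some \<Gamma>(N), hence
  \<Gamma>(m) by \<open>wohlfahrt\<close>, against the word w.\<close>

lemma not_congruence_subgroup:
  assumes m: "m \<ge> 1" and T: "\<And>x. x \<in> X \<Longrightarrow> act s r (concat (replicate m [True, True, True, False])) x = x"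
    and w: "word_mat w \<in> principal_congruence m" "x \<in> X" "act s r w x \<noteq> x"
  shows "\<not> congruence_subgroup H"
proof
  assume "congruence_subgroup H"
  then obtain N where N: "N \<ge> 1" "to_PSL2Z ` principal_congruence N \<subseteq> H"
    by (auto simp: congruence_subgroup_def)
  define K where "K = {word_mat w |w. \<forall>x\<in>X. act s r w x = x}"
  have "K \<lhd> SL2Z"
    unfolding SL.normal_inv_iff
  proof (intro conjI ballI)
    show "subgroup K SL2Z"
    proof (rule SL.subgroupI)
      show "K \<subseteq> carrier SL2Z" unfolding K_def using word_mat_closed by blast
      show "K \<noteq> {}" unfolding K_def by (auto intro!: exI[of _ "[]"])
    next
      fix A assume "A \<in> K"
      then obtain v where "A = word_mat v" "\<forall>x\<in>X. act s r v x = x" by (auto simp: K_def)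
      then show "inv\<^bsub>SL2Z\<^esub> A \<in> K"
        using act_word_inv_left[of _ v] unfolding K_def
        by (intro CollectI exI[of _ "word_inv v"]) (auto simp: word_mat_word_inv)
    next
      fix A B assume "A \<in> K" "B \<in> K"
      then obtain v w where "A = word_mat v" "\<forall>x\<in>X. act s r v x = x"
        "B = word_mat w" "\<forall>x\<in>X. act s r w x = x" by (auto simp: K_def)
      then show "A \<otimes>\<^bsub>SL2Z\<^esub> B \<in> K"
        unfolding K_def by (intro CollectI exI[of _ "v @ w"]) (auto simp: SL.wprod_append)
    qed
  next
    fix A B assume "A \<in> carrier SL2Z" "B \<in> K"
    then obtain v w where "A = word_mat v" "B = word_mat w" "\<forall>x\<in>X. act s r w x = x"
      using range_word_mat by (fastforce simp: K_def simp del: SL2Z_simps)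
    then show "A \<otimes>\<^bsub>SL2Z\<^esub> B \<otimes>\<^bsub>SL2Z\<^esub> inv\<^bsub>SL2Z\<^esub> A \<in> K"
      unfolding K_def using act_word_inv_right[of _ v]
      by (intro CollectI exI[of _ "v @ w @ word_inv v"])
        (auto simp: SL.wprod_append word_mat_word_inv act_in matrix_mul_assoc)
  qed
  moreover have "mat2 1 (int m) 0 1 \<in> K"
  proof -
    have "word_mat (concat (replicate m [True, True, True, False])) = mat2 1 (int m) 0 1"
      by (induction m) (simp_all add: mat_S_def mat_R_def)
    moreover have "word_mat (concat (replicate m [True, True, True, False])) \<in> K"
      unfolding K_def using T by blast
    ultimately show ?thesis by simp
  qed
  moreover have "principal_congruence N \<subseteq> K"
  proof
    fix A assume A: "A \<in> principal_congruence N"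
    then have "A \<in> carrier SL2Z" unfolding principal_congruence_def by blast
    then obtain v where v: "A = word_mat v" using range_word_mat by blast
    have "act s r w x0 = x0" if "word_mat w \<in> principal_congruence N" for w
      using that N(2) word_in_H[of w] to_PSL2Z_word_mat[of w] by blast
    then have "act s r v x = x" if "x \<in> X" for x
      using principal_congruence_acts_trivially that A v by blast
    with v show "A \<in> K" unfolding K_def by blast
  qed
  ultimately have "principal_congruence m \<subseteq> K"
    using wohlfahrt N(1) m by blast
  with w(1) obtain v where "word_mat w = word_mat v" "\<forall>x\<in>X. act s r v x = x"
    unfolding K_def by blast
  \<comment> \<open>Membership in K provides only some trivially acting word v for this matrix;
    well-definedness transfers this to w.\<close>
  then show False
    using act_well_defined[of w v x] w(2,3) by (metis to_PSL2Z_word_mat)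
qed

end

text \<open>The inverse turns right multiplication on right cosets into a left action, so that w
  sends H to H w^(-1), which is H exactly if w lies in H.\<close>

lemma coset_action:
  assumes "subgroup H PSL2Z"
  shows "stabilizer_action (rcosets\<^bsub>PSL2Z\<^esub> H) (\<lambda>c. c #>\<^bsub>PSL2Z\<^esub> inv\<^bsub>PSL2Z\<^esub> gen_S)
    (\<lambda>c. c #>\<^bsub>PSL2Z\<^esub> inv\<^bsub>PSL2Z\<^esub> gen_R) H H"
proof -
  interpret H: subgroup H PSL2Z by fact
  let ?s = "\<lambda>c. c #>\<^bsub>PSL2Z\<^esub> inv\<^bsub>PSL2Z\<^esub> gen_S" and ?r = "\<lambda>c. c #>\<^bsub>PSL2Z\<^esub> inv\<^bsub>PSL2Z\<^esub> gen_R"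
  have act: "act ?s ?r w (H #>\<^bsub>PSL2Z\<^esub> x) = H #>\<^bsub>PSL2Z\<^esub> (x \<otimes>\<^bsub>PSL2Z\<^esub> inv\<^bsub>PSL2Z\<^esub> word_PSL w)"
    if "x \<in> carrier PSL2Z" for w x
    using that by (induction w) (auto simp: PSL.coset_mult_assoc PSL.inv_mult_group PSL.m_assoc H.subset)
  have one: "H #>\<^bsub>PSL2Z\<^esub> \<one>\<^bsub>PSL2Z\<^esub> = H"
    by (simp add: PSL.coset_mult_one H.subset)
  have act1: "act ?s ?r w H = H #>\<^bsub>PSL2Z\<^esub> inv\<^bsub>PSL2Z\<^esub> word_PSL w" for w
    using act[of "\<one>\<^bsub>PSL2Z\<^esub>" w] by (simp add: one)
  have X: "c \<in> rcosets\<^bsub>PSL2Z\<^esub> H \<longleftrightarrow> (\<exists>x\<in>carrier PSL2Z. c = H #>\<^bsub>PSL2Z\<^esub> x)" for c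
    by (auto simp: RCOSETS_def)
  have word_eq: "act ?s ?r w c = c" if "c \<in> rcosets\<^bsub>PSL2Z\<^esub> H" "word_PSL w = \<one>\<^bsub>PSL2Z\<^esub>" for w c
    using that act[of _ w] by (auto simp: X)
  show ?thesis
  proof
    fix c assume c: "c \<in> rcosets\<^bsub>PSL2Z\<^esub> H"
    then obtain x where x: "x \<in> carrier PSL2Z" "c = H #>\<^bsub>PSL2Z\<^esub> x" by (auto simp: X)
    show "?s c \<in> rcosets\<^bsub>PSL2Z\<^esub> H" "?r c \<in> rcosets\<^bsub>PSL2Z\<^esub> H"
      using act[OF x(1), of "[True]"] act[OF x(1), of "[False]"] x by (auto simp: X)
    show "?s (?s c) = c" "?r (?r (?r c)) = c"
      using word_eq[OF c, of "[True, True]"] word_eq[OF c, of "[False, False, False]"]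
      by (simp_all add: PSL.s_square PSL.r_cube)
    obtain w where "inv\<^bsub>PSL2Z\<^esub> x = word_PSL w"
      using PSL.inv_closed[OF x(1)] by (auto simp only: carrier_PSL2Z_eq_range)
    then have "act ?s ?r w H = c" using x by (metis act1 PSL.inv_inv)
    then show "\<exists>w. act ?s ?r w H = c" ..
  next
    show "H \<in> rcosets\<^bsub>PSL2Z\<^esub> H" using one X by (metis PSL.one_closed)
    show "H \<subseteq> carrier PSL2Z" by (rule H.subset)
  next
    fix w
    have "word_PSL w \<in> H \<longleftrightarrow> inv\<^bsub>PSL2Z\<^esub> word_PSL w \<in> H"
      using H.m_inv_closed PSL.inv_inv by (metis PSL.wprod_closed gen_closed)
    also have "\<dots> \<longleftrightarrow> H #>\<^bsub>PSL2Z\<^esub> inv\<^bsub>PSL2Z\<^esub> word_PSL w = H"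
      using assms by (metis PSL.coset_join1 PSL.coset_join2 PSL.inv_closed PSL.wprod_closed gen_closed H.subset)
    finally show "word_PSL w \<in> H \<longleftrightarrow> act ?s ?r w H = H" by (simp add: act1)
  qed
qed

text \<open>Orbit-stabilizer: the coset action has the same point stabilizer.\<close>

lemma (in stabilizer_action) card_rcosets: "card (rcosets\<^bsub>PSL2Z\<^esub> H) = card X"
proof -
  interpret H: stabilizer_action "rcosets\<^bsub>PSL2Z\<^esub> H" "\<lambda>c. c #>\<^bsub>PSL2Z\<^esub> inv\<^bsub>PSL2Z\<^esub> gen_S"
    "\<lambda>c. c #>\<^bsub>PSL2Z\<^esub> inv\<^bsub>PSL2Z\<^esub> gen_R" H H
    by (rule coset_action[OF subgroup_H])
  show ?thesis
    by (rule card_eq_if_same_stabilizer[OF H.modular_action_axioms modular_action_axioms])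
      (simp flip: word_in_H H.word_in_H)
qed

subsection \<open>Enumeration of the actions on at most seven points\<close>

text \<open>Points are numbered from 1, list positions from 0.\<close>

definition perm_of :: "nat list \<Rightarrow> nat \<Rightarrow> nat" where
  "perm_of l x = l ! (x - 1)"

text \<open>
  A partial action on the points \<open>0, \<dots>, k - 1\<close> is recorded by labelled edges: \<open>(True, a, b)\<close>
  says that \<open>s\<close> maps \<open>a\<close> to \<open>b\<close>, and \<open>(False, a, b)\<close> the same for \<open>r\<close>. The search completes an
  \<open>s\<close>- or \<open>r\<close>-cycle at a time, every new member of it being an old point or the fresh point \<open>k\<close>.
\<close>

type_synonym edge = "bool \<times> nat \<times> nat"

text \<open>As cycles are entered whole, single-valuedness already excludes two edges into one
  point. Comparing \<open>new\<close> with itself discards impossible cycles such as i, i,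
  l.\<close>

definition compatible :: "edge list \<Rightarrow> edge list \<Rightarrow> bool" where
  "compatible new es \<longleftrightarrow>
     list_all (\<lambda>(g, a, b). list_all (\<lambda>(h, a', b'). g = h \<and> a = a' \<longrightarrow> b = b') es) new"

definition unassigned :: "nat \<Rightarrow> edge list \<Rightarrow> (bool \<times> nat) list" where
  "unassigned k es =
     filter (\<lambda>(g, i). \<not> list_ex (\<lambda>(h, a, b). g = h \<and> i = a) es)
       (concat (map (\<lambda>i. [(True, i), (False, i)]) [0..<k]))"

text \<open>\<open>max k (Suc j)\<close> counts the points once j is named: it exceeds k only for
  the fresh point j = k.\<close>

definition extensions :: "nat \<Rightarrow> nat \<Rightarrow> edge list \<Rightarrow> bool \<Rightarrow> nat \<Rightarrow> (nat \<times> edge list) list" where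
  "extensions m k es g i =
     filter (\<lambda>(k', new). k' \<le> m \<and> compatible new (new @ es))
       (if g then map (\<lambda>j. (max k (Suc j), [(True, i, j), (True, j, i)])) [0..<Suc k]
        else concat (map (\<lambda>j. map (\<lambda>l. (max (max k (Suc j)) (Suc l),
               [(False, i, j), (False, j, l), (False, l, i)])) [0..<Suc (max k (Suc j))]) [0..<Suc k]))"

text \<open>Without fuel the unfinished state is returned rather than dropped, so no action is lost
  for any fuel; \<open>recognized\<close> then rejects unfinished leaves.\<close>

fun search :: "nat \<Rightarrow> nat \<Rightarrow> nat \<Rightarrow> edge list \<Rightarrow> (nat \<times> edge list) list" where
  "search fuel m k es =
     (case unassigned k es of [] \<Rightarrow> [(k, es)]
      | (g, i) # _ \<Rightarrow> (case fuel of 0 \<Rightarrow> [(k, es)]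
          | Suc fuel' \<Rightarrow> concat (map (\<lambda>(k', new). search fuel' m k' (es @ new)) (extensions m k es g i))))"

declare search.simps [simp del]

text \<open>Grows an injection f from searched points to table points along the edges. In lists made
  by \<open>search\<close> a source is always named before its edge, so f has a value there once 0
  has one.\<close>

fun embed_edges :: "nat list \<Rightarrow> nat list \<Rightarrow> (nat \<times> nat) list \<Rightarrow> edge list \<Rightarrow> (nat \<times> nat) list option" where
  "embed_edges \<sigma> \<rho> f [] = Some f"
| "embed_edges \<sigma> \<rho> f ((g, a, b) # es) =
     (case map_of f a of None \<Rightarrow> None
      | Some x \<Rightarrow> let y = perm_of (if g then \<sigma> else \<rho>) x in
          (case map_of f b of
             None \<Rightarrow> if y \<in> snd ` set f then None else embed_edges \<sigma> \<rho> ((b, y) # f) es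
           | Some y' \<Rightarrow> if y = y' then embed_edges \<sigma> \<rho> f es else None))"

lemma in_unassigned: "(g, i) \<in> set (unassigned k es) \<longleftrightarrow> i < k \<and> (\<forall>b. (g, i, b) \<notin> set es)"
  by (cases g) (auto simp: unassigned_def list_ex_iff)

lemma embed_edges_SomeD:
  assumes "embed_edges \<sigma> \<rho> f es = Some f'"
    and "\<forall>a b x. map_of f a = Some x \<longrightarrow> map_of f b = Some x \<longrightarrow> a = b"
  shows "map_of f \<subseteq>\<^sub>m map_of f'"
    and "\<And>a b x. map_of f' a = Some x \<Longrightarrow> map_of f' b = Some x \<Longrightarrow> a = b"
    and "(g, a, b) \<in> set es \<Longrightarrow>
      \<exists>x. map_of f' a = Some x \<and> map_of f' b = Some (perm_of (if g then \<sigma> else \<rho>) x)"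
proof -
  have "map_of f \<subseteq>\<^sub>m map_of f' \<and>
    (\<forall>a b x. map_of f' a = Some x \<longrightarrow> map_of f' b = Some x \<longrightarrow> a = b) \<and>
    (\<forall>(g, a, b)\<in>set es. \<exists>x. map_of f' a = Some x \<and>
       map_of f' b = Some (perm_of (if g then \<sigma> else \<rho>) x))"
    using assms
  proof (induction es arbitrary: f)
    case (Cons e es)
    obtain g a b where e: "e = (g, a, b)" by (cases e)
    from Cons.prems(1) obtain x where x: "map_of f a = Some x"
      by (auto simp: e split: option.splits)
    define y where "y = perm_of (if g then \<sigma> else \<rho>) x"
    show ?case
    proof (cases "map_of f b")
      case None
      with Cons.prems(1) have emb: "embed_edges \<sigma> \<rho> ((b, y) # f) es = Some f'" and y: "y \<notin> snd ` set f"
        by (auto simp: e x y_def Let_def split: if_splits)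
      have fresh: "map_of f c \<noteq> Some y" for c
        using y by (metis image_eqI map_of_SomeD snd_conv)
      have IH: "map_of ((b, y) # f) \<subseteq>\<^sub>m map_of f' \<and>
        (\<forall>a b x. map_of f' a = Some x \<longrightarrow> map_of f' b = Some x \<longrightarrow> a = b) \<and>
        (\<forall>(g, a, b)\<in>set es. \<exists>x. map_of f' a = Some x \<and>
           map_of f' b = Some (perm_of (if g then \<sigma> else \<rho>) x))"
        by (rule Cons.IH[OF emb]) (use Cons.prems(2) fresh in \<open>auto split: if_splits\<close>)
      then have "map_of ((b, y) # f) \<subseteq>\<^sub>m map_of f'" ..
      moreover have "map_of f \<subseteq>\<^sub>m map_of ((b, y) # f)"
        using None by (auto simp: map_le_def)
      moreover have "map_of ((b, y) # f) b = Some y" by simp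
      moreover have "map_of ((b, y) # f) a = Some x" using x None by auto
      ultimately have "map_of f \<subseteq>\<^sub>m map_of f'" "map_of f' a = Some x" "map_of f' b = Some y"
        by (blast intro: map_le_trans, metis domI map_le_def, metis domI map_le_def)
      with IH show ?thesis unfolding e y_def by auto
    next
      case (Some y')
      with Cons.prems(1) have emb: "embed_edges \<sigma> \<rho> f es = Some f'" and "y' = y"
        by (auto simp: e x y_def Let_def split: if_splits)
      have IH: "map_of f \<subseteq>\<^sub>m map_of f' \<and>
        (\<forall>a b x. map_of f' a = Some x \<longrightarrow> map_of f' b = Some x \<longrightarrow> a = b) \<and>
        (\<forall>(g, a, b)\<in>set es. \<exists>x. map_of f' a = Some x \<and>
           map_of f' b = Some (perm_of (if g then \<sigma> else \<rho>) x))"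
        by (rule Cons.IH[OF emb Cons.prems(2)])
      then have "map_of f' a = Some x" "map_of f' b = Some y"
        using x Some \<open>y' = y\<close> by (metis domI map_le_def)+
      with IH show ?thesis unfolding e y_def by auto
    qed
  qed auto
  then show "map_of f \<subseteq>\<^sub>m map_of f'"
    and "\<And>a b x. map_of f' a = Some x \<Longrightarrow> map_of f' b = Some x \<Longrightarrow> a = b"
    and "(g, a, b) \<in> set es \<Longrightarrow>
      \<exists>x. map_of f' a = Some x \<and> map_of f' b = Some (perm_of (if g then \<sigma> else \<rho>) x)"
    by fast+
qed

section \<open>Soundness of the search\<close>

context modular_action
begin

text \<open>The search invariant: \<iota> identifies the abstract points with distinct points of the
  given action, 0 being the base point.\<close>

definition realizes :: "(nat \<Rightarrow> 'x) \<Rightarrow> nat \<Rightarrow> edge list \<Rightarrow> bool" where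
  "realizes \<iota> k es \<longleftrightarrow> 0 < k \<and> \<iota> 0 = x0 \<and> inj_on \<iota> {..<k} \<and> \<iota> ` {..<k} \<subseteq> X \<and>
     (\<forall>g a b. (g, a, b) \<in> set es \<longrightarrow> a < k \<and> b < k \<and> (if g then s else r) (\<iota> a) = \<iota> b)"

lemma realizes_compatible:
  assumes real: "realizes \<iota> k es" and sub: "set new \<subseteq> set es"
  shows "compatible new es"
proof -
  have "b = b'" if "(g, a, b) \<in> set new" "(g, a, b') \<in> set es" for g a b b'
  proof -
    have "b < k" "b' < k" "\<iota> b = \<iota> b'"
      using real that sub unfolding realizes_def by (blast, blast, metis subsetD)
    with real show ?thesis unfolding realizes_def inj_on_def by blast
  qed
  then show ?thesis unfolding compatible_def list_all_iff by fast
qed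

text \<open>Either y has a name already, or it receives the fresh name k.\<close>

lemma realizes_name:
  assumes "realizes \<iota> k es" "y \<in> X"
  obtains j \<iota>' where "j \<le> k" "realizes \<iota>' (max k (Suc j)) es" "\<iota>' j = y" "\<And>i. i < k \<Longrightarrow> \<iota>' i = \<iota> i"
proof (cases "y \<in> \<iota> ` {..<k}")
  case True
  then obtain j where "j < k" "\<iota> j = y" by blast
  moreover from this(1) have "max k (Suc j) = k" by simp
  ultimately show ?thesis using assms by (intro that[of j \<iota>]) simp_all
next
  case False
  have "a < Suc k \<and> b < Suc k \<and> (if g then s else r) ((\<iota>(k := y)) a) = (\<iota>(k := y)) b"
    if "(g, a, b) \<in> set es" for g a b
  proof -
    have "a < k" "b < k" "(if g then s else r) (\<iota> a) = \<iota> b"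
      using assms(1) that unfolding realizes_def by blast+
    then show ?thesis by simp
  qed
  then have "realizes (\<iota>(k := y)) (Suc k) es"
    using assms False unfolding realizes_def lessThan_Suc
    by (auto simp: inj_on_def simp del: fun_upd_apply) (auto simp: inj_on_def)
  moreover have "max k (Suc k) = Suc k" by simp
  ultimately show ?thesis by (intro that[of k "\<iota>(k := y)"]) simp_all
qed

lemma realizes_bound:
  assumes "realizes \<iota> k es" "finite X"
  shows "k \<le> card X"
  using assms card_inj_on_le[of \<iota> "{..<k}" X] by (simp add: realizes_def)

lemma realizes_append:
  assumes "realizes \<iota> k es" "\<And>g a b. (g, a, b) \<in> set new \<Longrightarrow> a < k \<and> b < k \<and> (if g then s else r) (\<iota> a) = \<iota> b"
  shows "realizes \<iota> k (es @ new)"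
  using assms by (auto simp: realizes_def)

lemma extensions_sound:
  assumes real: "realizes \<iota> k es" and i: "i < k" and X: "finite X" "card X \<le> m"
  shows "\<exists>k' new \<iota>'. (k', new) \<in> set (extensions m k es g i) \<and> realizes \<iota>' k' (es @ new)"
proof -
  have ok: "k' \<le> m \<and> compatible new (new @ es)" if r: "realizes \<iota>' k' (es @ new)" for \<iota>' k' new
  proof
    show "k' \<le> m" using realizes_bound[OF r X(1)] X(2) by simp
    have "realizes \<iota>' k' (new @ es)" using r by (auto simp: realizes_def)
    then show "compatible new (new @ es)" by (rule realizes_compatible) simp
  qed
  have \<iota>i: "\<iota> i \<in> X" using real i by (auto simp: realizes_def)
  show ?thesis
  proof (cases g)
    case True
    obtain j \<iota>' where j: "j \<le> k" "realizes \<iota>' (max k (Suc j)) es" "\<iota>' j = s (\<iota> i)" "\<And>i. i < k \<Longrightarrow> \<iota>' i = \<iota> i"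
      using realizes_name[OF real s_in[OF \<iota>i]] by blast
    have "realizes \<iota>' (max k (Suc j)) (es @ [(True, i, j), (True, j, i)])"
      by (rule realizes_append[OF j(2)]) (use i j \<iota>i in \<open>auto simp: s_s\<close>)
    moreover from ok[OF this] have "(max k (Suc j), [(True, i, j), (True, j, i)]) \<in> set (extensions m k es g i)"
      using True j(1) by (auto simp: extensions_def simp del: upt_Suc)
    ultimately show ?thesis by blast
  next
    case False
    obtain j \<iota>1 where j: "j \<le> k" "realizes \<iota>1 (max k (Suc j)) es" "\<iota>1 j = r (\<iota> i)" "\<And>i. i < k \<Longrightarrow> \<iota>1 i = \<iota> i"
      using realizes_name[OF real r_in[OF \<iota>i]] by blast
    obtain l \<iota>' where l: "l \<le> max k (Suc j)" "realizes \<iota>' (max (max k (Suc j)) (Suc l)) es"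
      "\<iota>' l = r (r (\<iota> i))" "\<And>i. i < max k (Suc j) \<Longrightarrow> \<iota>' i = \<iota>1 i"
      using realizes_name[OF j(2) r_in[OF r_in[OF \<iota>i]]] by blast
    let ?new = "[(False, i, j), (False, j, l), (False, l, i)]"
    have "realizes \<iota>' (max (max k (Suc j)) (Suc l)) (es @ ?new)"
      by (rule realizes_append[OF l(2)]) (use i j l \<iota>i in \<open>auto simp: r_r_r\<close>)
    moreover from ok[OF this] have "(max (max k (Suc j)) (Suc l), ?new) \<in> set (extensions m k es g i)"
      using False j(1) l(1)
      by (auto simp: extensions_def simp del: upt_Suc intro!: bexI[of _ j] image_eqI[of _ _ l])
    ultimately show ?thesis by blast
  qed
qed

text \<open>Follow the branch dictated by the given action. The filter cannot remove it, since
  injectivity of \<iota> bounds the number of names by \<open>card X\<close> and its edges come from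
  actual maps.\<close>

lemma search_sound:
  assumes "realizes \<iota> k es" "finite X" "card X \<le> m"
  shows "\<exists>k' es' \<iota>'. (k', es') \<in> set (search fuel m k es) \<and> realizes \<iota>' k' es'"
  using assms(1)
proof (induction fuel arbitrary: \<iota> k es)
  case 0
  then show ?case
    by (subst search.simps) (auto split: list.splits prod.splits)
next
  case (Suc fuel)
  show ?case
  proof (cases "unassigned k es")
    case Nil
    with Suc.prems show ?thesis by (subst search.simps) auto
  next
    case (Cons gi rest)
    obtain g i where gi: "gi = (g, i)" by (cases gi)
    with Cons have "i < k" using in_unassigned[of g i k es] by simp
    then obtain k' new \<iota>' where "(k', new) \<in> set (extensions m k es g i)" "realizes \<iota>' k' (es @ new)"
      using extensions_sound[OF Suc.prems _ assms(2,3)] by blast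
    moreover from this(2) obtain k'' es'' \<iota>'' where
      "(k'', es'') \<in> set (search fuel m k' (es @ new))" "realizes \<iota>'' k'' es''"
      using Suc.IH by blast
    ultimately show ?thesis
      by (subst search.simps) (force simp: Cons gi)
  qed
qed

text \<open>One walk on abstract points, never stuck because nothing is unassigned, shadows the
  walks in both actions. Both namings are injective, so either walk is back at its start exactly
  when the abstract point is 0.\<close>

lemma stabilizer_of_embedding:
  assumes real: "realizes \<iota> k es" and total: "unassigned k es = []"
    and emb: "embed_edges \<sigma> \<rho> [(0, j)] es = Some f"
  shows "act s r w x0 = x0 \<longleftrightarrow> act (perm_of \<sigma>) (perm_of \<rho>) w j = j"
proof -
  have "\<forall>a b x. map_of [(0::nat, j)] a = Some x \<longrightarrow> map_of [(0, j)] b = Some x \<longrightarrow> a = b"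
    by (simp split: if_splits)
  note f = embed_edges_SomeD[OF emb this]
  have f0: "map_of f 0 = Some j"
    using f(1) by (simp add: map_le_def)
  have "\<exists>i<k. act s r w x0 = \<iota> i \<and> map_of f i = Some (act (perm_of \<sigma>) (perm_of \<rho>) w j)"
  proof (induction w)
    case Nil
    with real f0 show ?case by (auto simp: realizes_def)
  next
    case (Cons g w)
    then obtain i where i: "i < k" "act s r w x0 = \<iota> i"
      "map_of f i = Some (act (perm_of \<sigma>) (perm_of \<rho>) w j)" by blast
    then obtain b where b: "(g, i, b) \<in> set es"
      using total in_unassigned[of g i k es] by auto
    then have "b < k" "(if g then s else r) (\<iota> i) = \<iota> b"
      using real by (auto simp: realizes_def)
    moreover have "map_of f b = Some (perm_of (if g then \<sigma> else \<rho>) (act (perm_of \<sigma>) (perm_of \<rho>) w j))"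
      using f(3)[OF b] i(3) by simp
    ultimately show ?case
      using i(2) by (intro exI[of _ b]) auto
  qed
  then obtain i where i: "i < k" "act s r w x0 = \<iota> i"
    "map_of f i = Some (act (perm_of \<sigma>) (perm_of \<rho>) w j)" by blast
  have "\<iota> i = x0 \<longleftrightarrow> i = 0"
    using real i(1) unfolding realizes_def inj_on_def by auto
  moreover have "act (perm_of \<sigma>) (perm_of \<rho>) w j = j \<longleftrightarrow> i = 0"
    using f(2)[of i _ 0] f0 i(3) by auto
  ultimately show ?thesis using i(2) by simp
qed

end

text \<open>
  One representative per isomorphism class of transitive actions on at most seven points, given by
  the images of the points \<open>1, 2, \<dots>\<close> under \<open>S\<close> and under \<open>R\<close>, and preceded by its level in the
  congruence case.
\<close>

definition congruence_tables :: "(nat \<times> nat list \<times> nat list) list" where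
  "congruence_tables =
    [(1, [1], [1]),
     (2, [2, 1], [1, 2]),
     (2, [1, 3, 2], [2, 3, 1]),
     (3, [1, 2, 3], [2, 3, 1]),
     (3, [2, 1, 4, 3], [1, 3, 4, 2]),
     (4, [1, 2, 4, 3], [2, 3, 1, 4]),
     (5, [1, 4, 5, 2, 3], [2, 3, 1, 4, 5]),
     (2, [2, 1, 6, 5, 4, 3], [3, 5, 4, 1, 6, 2]),
     (3, [1, 4, 5, 2, 3, 6], [2, 3, 1, 5, 6, 4]),
     (4, [1, 4, 5, 2, 3, 6], [2, 3, 1, 6, 4, 5]),
     (4, [2, 1, 4, 3, 6, 5], [2, 3, 1, 5, 6, 4]),
     (5, [1, 2, 4, 3, 6, 5], [2, 3, 1, 5, 6, 4]),
     (6, [1, 2, 4, 3, 5, 6], [2, 3, 1, 5, 6, 4]),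
     (6, [2, 1, 5, 6, 3, 4], [1, 3, 4, 2, 5, 6]),
     (6, [2, 1, 5, 6, 3, 4], [3, 5, 4, 1, 6, 2]),
     (7, [1, 2, 4, 3, 5, 7, 6], [2, 3, 1, 5, 6, 4, 7]),
     (7, [1, 2, 4, 3, 7, 6, 5], [2, 3, 1, 5, 6, 4, 7])]"

text \<open>The pairs defining \<open>phi1\<close> to \<open>phi4\<close>, in this order, on which
  the later uses of \<open>zip\<close> rely.\<close>

definition noncongruence_tables :: "(nat list \<times> nat list) list" where
  "noncongruence_tables =
    [([2, 1, 4, 3, 6, 5, 7], [1, 3, 5, 6, 2, 7, 4]),
     ([2, 1, 4, 3, 6, 5, 7], [1, 3, 5, 7, 2, 4, 6]),
     ([2, 1, 4, 3, 5, 7, 6], [1, 3, 5, 6, 2, 7, 4]),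
     ([2, 1, 4, 3, 5, 7, 6], [1, 5, 2, 6, 3, 7, 4])]"

text \<open>The tables list actions without a base point, so every j is tried as image of the base
  point 0.\<close>

definition recognized :: "nat \<times> edge list \<Rightarrow> bool" where
  "recognized = (\<lambda>(k, es). unassigned k es = [] \<and>
     list_ex (\<lambda>(\<sigma>, \<rho>). length \<sigma> = k \<and>
       list_ex (\<lambda>j. embed_edges \<sigma> \<rho> [(0, j)] es \<noteq> None) [1..<Suc k])
     (noncongruence_tables @ map snd congruence_tables))"

text \<open>The fuel is 14 = 2 * 7, because each round fills at least one slot \<open>(g, i)\<close>
  and seven points have 14 slots.\<close>

lemma search_recognized: "list_all recognized (search 14 7 1 [])"
  by code_simp

section \<open>The tables as transitive actions, and the classification\<close>

fun reachable :: "nat list \<Rightarrow> nat list \<Rightarrow> nat \<Rightarrow> nat list" where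
  "reachable \<sigma> \<rho> 0 = [1]"
| "reachable \<sigma> \<rho> (Suc n) =
     (let xs = reachable \<sigma> \<rho> n in remdups (xs @ map (perm_of \<sigma>) xs @ map (perm_of \<rho>) xs))"

definition modular_table :: "nat list \<times> nat list \<Rightarrow> bool" where
  "modular_table = (\<lambda>(\<sigma>, \<rho>).
     \<sigma> \<noteq> [] \<and>
     list_all (\<lambda>x. 1 \<le> perm_of \<sigma> x \<and> perm_of \<sigma> x \<le> length \<sigma> \<and>
       1 \<le> perm_of \<rho> x \<and> perm_of \<rho> x \<le> length \<sigma> \<and>
       perm_of \<sigma> (perm_of \<sigma> x) = x \<and> perm_of \<rho> (perm_of \<rho> (perm_of \<rho> x)) = x \<and>
       x \<in> set (reachable \<sigma> \<rho> (length \<sigma>))) [1..<Suc (length \<sigma>)])"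

lemma modular_tables:
  "list_all modular_table (noncongruence_tables @ map snd congruence_tables)"
  by code_simp

lemma modular_action_table:
  assumes "modular_table (\<sigma>, \<rho>)" "j \<in> {1..length \<sigma>}"
  shows "modular_action {1..length \<sigma>} (perm_of \<sigma>) (perm_of \<rho>) j"
proof -
  have reach: "\<exists>w. act (perm_of \<sigma>) (perm_of \<rho>) w 1 = x" if "x \<in> set (reachable \<sigma> \<rho> n)" for n x
    using that
  proof (induction n arbitrary: x)
    case 0
    then show ?case by (auto intro: exI[of _ "[]"])
  next
    case (Suc n)
    then consider "x \<in> set (reachable \<sigma> \<rho> n)" | y where "y \<in> set (reachable \<sigma> \<rho> n)" "x = perm_of \<sigma> y"
      | y where "y \<in> set (reachable \<sigma> \<rho> n)" "x = perm_of \<rho> y"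
      by (auto simp: Let_def)
    then show ?case
    proof cases
      case (2 y)
      then obtain w where "act (perm_of \<sigma>) (perm_of \<rho>) w 1 = y" using Suc.IH by blast
      with 2 show ?thesis by (intro exI[of _ "True # w"]) simp
    next
      case (3 y)
      then obtain w where "act (perm_of \<sigma>) (perm_of \<rho>) w 1 = y" using Suc.IH by blast
      with 3 show ?thesis by (intro exI[of _ "False # w"]) simp
    qed (use Suc.IH in blast)
  qed
  have "modular_action {1..length \<sigma>} (perm_of \<sigma>) (perm_of \<rho>) 1"
  proof
    fix x assume "x \<in> {1..length \<sigma>}"
    then have "x \<in> set (reachable \<sigma> \<rho> (length \<sigma>))"
      using assms(1) by (auto simp: modular_table_def list_all_iff simp del: upt_Suc)
    then show "\<exists>w. act (perm_of \<sigma>) (perm_of \<rho>) w 1 = x" by (rule reach)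
  qed (use assms(1) in \<open>auto simp: modular_table_def list_all_iff Suc_le_eq simp del: upt_Suc\<close>)
  then show ?thesis
    by (rule modular_action.change_base) (rule assms(2))
qed

lemma (in modular_action) classification:
  assumes "finite X" "card X \<le> 7"
  obtains \<sigma> \<rho> j where "(\<sigma>, \<rho>) \<in> set (noncongruence_tables @ map snd congruence_tables)"
    "length \<sigma> = card X" "j \<in> {1..card X}"
    "\<And>w. act s r w x0 = x0 \<longleftrightarrow> act (perm_of \<sigma>) (perm_of \<rho>) w j = j"
proof -
  have "realizes (\<lambda>_. x0) 1 []"
    using base_in by (auto simp: realizes_def lessThan_Suc)
  from search_sound[OF this assms] obtain k es \<iota> where
    leaf: "(k, es) \<in> set (search 14 7 1 [])" and real: "realizes \<iota> k es" by blast
  have "recognized (k, es)"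
    using search_recognized leaf unfolding list_all_iff by blast
  then have total: "unassigned k es = []"
    and "\<exists>(\<sigma>, \<rho>)\<in>set (noncongruence_tables @ map snd congruence_tables). length \<sigma> = k \<and>
      (\<exists>j\<in>set [1..<Suc k]. embed_edges \<sigma> \<rho> [(0, j)] es \<noteq> None)"
    unfolding recognized_def list_ex_iff prod.case by blast+
  then obtain \<sigma> \<rho> j f where table: "(\<sigma>, \<rho>) \<in> set (noncongruence_tables @ map snd congruence_tables)"
    and k: "length \<sigma> = k" "j \<in> set [1..<Suc k]" "embed_edges \<sigma> \<rho> [(0, j)] es = Some f"
    by blast
  have j: "j \<in> {1..k}" using k(2) by (simp del: upt_Suc)
  have stab: "act s r w x0 = x0 \<longleftrightarrow> act (perm_of \<sigma>) (perm_of \<rho>) w j = j" for w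
    by (rule stabilizer_of_embedding[OF real total k(3)])
  have "modular_table (\<sigma>, \<rho>)"
    using modular_tables table unfolding list_all_iff by blast
  then have "modular_action {1..k} (perm_of \<sigma>) (perm_of \<rho>) j"
    using modular_action_table k(1) j by blast
  from card_eq_if_same_stabilizer[OF modular_action_axioms this stab] have "card X = k" by simp
  then show thesis using k(1) j by (intro that[OF table _ _ stab]) simp_all
qed

text \<open>A state \<open>(a, b, c, d, x)\<close> is the matrix with rows \<open>(a, b)\<close> and \<open>(c, d)\<close> modulo \<open>N\<close> and a point.\<close>

type_synonym residue_state = "nat \<times> nat \<times> nat \<times> nat \<times> nat"

text \<open>Left multiplication by S gives the rows -(c, d) and (a, b), by R the rows -(c, d) and (a
  + c, b + d). Residues stay below N, so one comparison replaces a division.\<close>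

definition successors :: "nat \<Rightarrow> nat list \<Rightarrow> nat list \<Rightarrow> residue_state \<Rightarrow> residue_state list" where
  "successors N \<sigma> \<rho> = (\<lambda>(a, b, c, d, x).
     let neg = (\<lambda>x. if x = 0 then 0 else N - x);
         add = (\<lambda>x y. if x + y < N then x + y else x + y - N)
     in [(neg c, neg d, a, b, perm_of \<sigma> x), (neg c, neg d, add a c, add b d, perm_of \<rho> x)])"

fun bucket :: "nat \<Rightarrow> 'q list list \<Rightarrow> 'q list" where
  "bucket n [] = []"
| "bucket 0 (b # bs) = b"
| "bucket (Suc n) (b # bs) = bucket n bs"

fun insert_bucket :: "nat \<Rightarrow> 'q \<Rightarrow> 'q list list \<Rightarrow> 'q list list" where
  "insert_bucket 0 q [] = [[q]]"
| "insert_bucket (Suc n) q [] = [] # insert_bucket n q []"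
| "insert_bucket 0 q (b # bs) = (q # b) # bs"
| "insert_bucket (Suc n) q (b # bs) = b # insert_bucket n q bs"

fun absorb :: "('q \<Rightarrow> nat) \<Rightarrow> 'q list \<Rightarrow> 'q list \<Rightarrow> 'q list list \<Rightarrow> 'q list \<times> 'q list list" where
  "absorb h [] new seen = (new, seen)"
| "absorb h (q # qs) new seen =
     (let n = h q in
      if q \<in> set (bucket n seen) then absorb h qs new seen
      else absorb h qs (q # new) (insert_bucket n q seen))"

text \<open>
  The visited states are hashed into buckets; \<open>front\<close> holds those whose successors have not yet been
  visited.
\<close>

fun saturate :: "nat \<Rightarrow> ('q \<Rightarrow> nat) \<Rightarrow> ('q \<Rightarrow> 'q list) \<Rightarrow> 'q list \<Rightarrow> 'q list list
    \<Rightarrow> 'q list list option" where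
  "saturate fuel h next front seen = (if front = [] then Some seen else
     (case fuel of 0 \<Rightarrow> None
      | Suc n \<Rightarrow> (case absorb h (concat (map next front)) [] seen of
          (new, seen') \<Rightarrow> saturate n h next new seen')))"

declare saturate.simps [simp del]

definition hash :: "nat \<Rightarrow> residue_state \<Rightarrow> nat" where
  "hash N = (\<lambda>(a, b, c, d, x). N * a + c)"

definition residue_one :: "nat \<Rightarrow> nat" where
  "residue_one N = (if N = 1 then 0 else 1)"

text \<open>The hash ignores the point x, so all states over the identity matrix share one bucket,
  and inspecting that bucket is enough. If 30 rounds did not reach closure, the result would be
  \<open>False\<close>.\<close>

definition certified :: "nat \<times> nat list \<times> nat list \<Rightarrow> bool" where
  "certified = (\<lambda>(N, \<sigma>, \<rho>). N \<noteq> 0 \<and>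
     (let e = residue_one N; q = (e, 0, 0, e, 1); n = hash N q
      in case saturate 30 (hash N) (successors N \<sigma> \<rho>) [q] (insert_bucket n q []) of
           None \<Rightarrow> False
         | Some seen \<Rightarrow> list_all (\<lambda>(a, b, c, d, x).
             a = e \<and> b = 0 \<and> c = 0 \<and> d = e \<longrightarrow> x = 1) (bucket n seen)))"

lemma congruence_tables_certified: "list_all certified congruence_tables"
  by code_simp

section \<open>Correctness of the saturation\<close>

lemma bucket_insert_bucket:
  "bucket m (insert_bucket n q bs) = (if m = n then q # bucket m bs else bucket m bs)"
proof (induction n q bs arbitrary: m rule: insert_bucket.induct)
  case (1 q)
  then show ?case by (cases m) auto
next
  case (2 n q)
  then show ?case by (cases m) auto
next
  case (3 q b bs)
  then show ?case by (cases m) auto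
next
  case (4 n q b bs)
  then show ?case by (cases m) auto
qed

lemma absorb_stored:
  assumes "absorb h qs new seen = (new', seen')"
  shows "(\<forall>q. q \<in> set (bucket (h q) seen) \<longrightarrow> q \<in> set (bucket (h q) seen')) \<and>
    (\<forall>q\<in>set qs. q \<in> set (bucket (h q) seen')) \<and>
    (\<forall>q. q \<in> set (bucket (h q) seen') \<longrightarrow> q \<in> set (bucket (h q) seen) \<or> q \<in> set new') \<and>
    set new \<subseteq> set new'"
  using assms
proof (induction qs arbitrary: new seen)
  case (Cons q qs)
  show ?case
  proof (cases "q \<in> set (bucket (h q) seen)")
    case True
    with Cons.prems have "absorb h qs new seen = (new', seen')" by simp
    from Cons.IH[OF this] True show ?thesis by simp
  next
    case False
    with Cons.prems have "absorb h qs (q # new) (insert_bucket (h q) q seen) = (new', seen')" by simp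
    from Cons.IH[OF this] show ?thesis
      by (auto simp: bucket_insert_bucket split: if_splits)
  qed
qed auto

text \<open>Invariant: a stored state is in the front or has all its successors stored. Success
  means an empty front, hence a closed set.\<close>

lemma saturate_closed:
  assumes "saturate fuel h next front seen = Some L"
    and "\<And>q. q \<in> set (bucket (h q) seen) \<Longrightarrow>
      q \<in> set front \<or> (\<forall>q'\<in>set (next q). q' \<in> set (bucket (h q') seen))"
  shows "(\<forall>q. q \<in> set (bucket (h q) seen) \<longrightarrow> q \<in> set (bucket (h q) L)) \<and>
    (\<forall>q. q \<in> set (bucket (h q) L) \<longrightarrow> (\<forall>q'\<in>set (next q). q' \<in> set (bucket (h q') L)))"
  using assms
proof (induction fuel arbitrary: front seen)
  case 0
  then show ?case by (auto simp: saturate.simps split: if_splits)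
next
  case (Suc fuel)
  show ?case
  proof (cases "front = []")
    case True
    with Suc.prems show ?thesis by (auto simp: saturate.simps)
  next
    case False
    obtain new seen' where ab: "absorb h (concat (map next front)) [] seen = (new, seen')"
      by (cases "absorb h (concat (map next front)) [] seen")
    with Suc.prems(1) False have sat: "saturate fuel h next new seen' = Some L"
      by (subst (asm) saturate.simps) simp
    have st: "\<And>q. q \<in> set (bucket (h q) seen) \<Longrightarrow> q \<in> set (bucket (h q) seen')"
      "\<And>p q. p \<in> set front \<Longrightarrow> q \<in> set (next p) \<Longrightarrow> q \<in> set (bucket (h q) seen')"
      "\<And>q. q \<in> set (bucket (h q) seen') \<Longrightarrow> q \<in> set (bucket (h q) seen) \<or> q \<in> set new"
      using absorb_stored[OF ab] by auto
    have "q \<in> set new \<or> (\<forall>q'\<in>set (next q). q' \<in> set (bucket (h q') seen'))"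
      if "q \<in> set (bucket (h q) seen')" for q
      using st(3)[OF that] Suc.prems(2)[of q] st(1,2) by blast
    from Suc.IH[OF sat this] st(1) show ?thesis by blast
  qed
qed

definition residue_state :: "nat \<Rightarrow> int^2^2 \<Rightarrow> nat \<Rightarrow> residue_state" where
  "residue_state N A x = (nat (A $ 1 $ 1 mod int N), nat (A $ 1 $ 2 mod int N),
     nat (A $ 2 $ 1 mod int N), nat (A $ 2 $ 2 mod int N), x)"

lemma successors_residue_state:
  assumes "N \<noteq> 0"
  shows "successors N \<sigma> \<rho> (residue_state N A x) =
    [residue_state N (mat_S ** A) (perm_of \<sigma> x), residue_state N (mat_R ** A) (perm_of \<rho> x)]"
proof -
  have neg: "(if nat (u mod int N) = 0 then 0 else N - nat (u mod int N)) = nat (- u mod int N)" for u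
  proof -
    have "0 \<le> u mod int N" "u mod int N < int N" using assms by simp_all
    then show ?thesis by (auto simp: zmod_zminus1_eq_if nat_diff_distrib)
  qed
  have add: "(if nat (u mod int N) + nat (v mod int N) < N then nat (u mod int N) + nat (v mod int N)
      else nat (u mod int N) + nat (v mod int N) - N) = nat ((u + v) mod int N)" for u v
  proof -
    define p q where "p = u mod int N" and "q = v mod int N"
    have pq: "0 \<le> p" "p < int N" "0 \<le> q" "q < int N" using assms by (simp_all add: p_def q_def)
    have "(u + v) mod int N = (p + q) mod int N" by (simp add: p_def q_def mod_add_eq)
    also have "\<dots> = (if p + q < int N then p + q else p + q - int N)"
    proof (cases "p + q < int N")
      case False
      have "(p + q) mod int N = (p + q - int N) mod int N" by simp
      also have "\<dots> = p + q - int N" using pq False by (intro mod_pos_pos_trivial) auto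
      finally show ?thesis using False by simp
    qed (use pq in simp)
    finally have "nat ((u + v) mod int N) = nat (if p + q < int N then p + q else p + q - int N)" by simp
    then show ?thesis
      unfolding p_def[symmetric] q_def[symmetric] using pq by (auto split: if_splits)
  qed
  obtain a b c d where "A = mat2 a b c d" by (cases A)
  then show ?thesis
    unfolding successors_def residue_state_def prod.case Let_def neg add
    by (simp add: mat_S_def mat_R_def)
qed

text \<open>By closure the stored set contains the state of every word, starting from the empty one.
  For a word in \<Gamma>(N) the matrix part is the identity, and the check forces the point
  1.\<close>

lemma certified_fixes:
  assumes "certified (N, \<sigma>, \<rho>)" "word_mat w \<in> principal_congruence N"
  shows "act (perm_of \<sigma>) (perm_of \<rho>) w 1 = 1"
proof -
  let ?q = "\<lambda>x. (residue_one N, 0, 0, residue_one N, x)"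
  have N: "N \<noteq> 0" using assms(1) by (simp add: certified_def)
  obtain L where
    sat: "saturate 30 (hash N) (successors N \<sigma> \<rho>) [?q 1] (insert_bucket (hash N (?q 1)) (?q 1) []) = Some L"
    and "list_all (\<lambda>(a, b, c, d, x). a = residue_one N \<and> b = 0 \<and> c = 0 \<and> d = residue_one N \<longrightarrow> x = 1)
      (bucket (hash N (?q 1)) L)"
    using assms(1) unfolding certified_def Let_def prod.case by (auto split: option.splits)
  then have L: "x = 1" if "?q x \<in> set (bucket (hash N (?q x)) L)" for x
    using that by (auto simp: list_all_iff hash_def)
  have one: "residue_state N A x = (residue_one N, 0, 0, residue_one N, x)"
    if "A \<in> principal_congruence N" for A x
  proof -
    obtain a b c d where A: "A = mat2 a b c d" by (cases A)
    then have "a mod int N = 1 mod int N" "b mod int N = 0" "c mod int N = 0" "d mod int N = 1 mod int N"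
      using that by (simp_all add: mat2_in_principal_congruence mod_eq_dvd_iff)
    moreover have "nat (1 mod int N) = residue_one N"
      using N by (cases "N = 1") (auto simp: residue_one_def)
    ultimately show ?thesis by (simp add: residue_state_def A)
  qed
  have closed: "?q 1 \<in> set (bucket (hash N (?q 1)) L)"
    "\<And>q q'. q \<in> set (bucket (hash N q) L) \<Longrightarrow> q' \<in> set (successors N \<sigma> \<rho> q) \<Longrightarrow> q' \<in> set (bucket (hash N q') L)"
  proof -
    have start: "q \<in> set (bucket (hash N q) (insert_bucket (hash N p) p [])) \<longleftrightarrow> q = p" for p q
      by (auto simp: bucket_insert_bucket)
    have "q \<in> set [?q 1] \<or> (\<forall>q'\<in>set (successors N \<sigma> \<rho> q).
        q' \<in> set (bucket (hash N q') (insert_bucket (hash N (?q 1)) (?q 1) [])))"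
      if "q \<in> set (bucket (hash N q) (insert_bucket (hash N (?q 1)) (?q 1) []))" for q
      using that unfolding start by simp
    from saturate_closed[OF sat this] show "?q 1 \<in> set (bucket (hash N (?q 1)) L)"
      "\<And>q q'. q \<in> set (bucket (hash N q) L) \<Longrightarrow> q' \<in> set (successors N \<sigma> \<rho> q) \<Longrightarrow> q' \<in> set (bucket (hash N q') L)"
      unfolding start by blast+
  qed
  let ?st = "\<lambda>v. residue_state N (word_mat v) (act (perm_of \<sigma>) (perm_of \<rho>) v 1)"
  have "?st v \<in> set (bucket (hash N (?st v)) L)" for v
  proof (induction v)
    case Nil
    have "mat2 1 0 0 1 \<in> principal_congruence N" by (simp add: mat2_in_principal_congruence)
    with one closed(1) show ?case by simp
  next
    case (Cons g v)
    moreover have "?st (g # v) \<in> set (successors N \<sigma> \<rho> (?st v))"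
      by (simp add: successors_residue_state[OF N])
    ultimately show ?case by (rule closed(2))
  qed
  from this[of w] show ?thesis
    unfolding one[OF assms(2)] by (rule L)
qed

subsection \<open>Congruence and noncongruence stabilizers\<close>

text \<open>
  The pairs consist of the order \<open>m\<close> of \<open>T\<close> in the respective action and a word in \<open>\<Gamma>(m)\<close> acting
  nontrivially; the prefix \<open>[True, True]\<close> stands for \<open>-1\<close>.
\<close>

definition noncongruence_witnesses :: "(nat \<times> bool list) list" where
  "noncongruence_witnesses =
    [(12, letters (0, [False, False, True, False, False, False, True, True, False, True, True, True], False)),
     (10, [True, True] @ letters (0, [False, True, False, True, True, False, True, False, True, True], False)),
     (6, letters (0, [False, True, False, False, True, False, True, True], False)),
     (6, letters (0, [False, True, False, False, True, False, True, True], False))]"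

lemma witness_in_principal_congruence:
  "list_all (\<lambda>(m, w). word_mat w \<in> principal_congruence m) noncongruence_witnesses"
  by (simp add: noncongruence_witnesses_def mat_S_def mat_R_def mat2_in_principal_congruence)

lemma witness_acts_nontrivially:
  "list_all (\<lambda>((\<sigma>, \<rho>), (m, w)). m \<noteq> 0 \<and>
     list_all (\<lambda>x. act (perm_of \<sigma>) (perm_of \<rho>) (concat (replicate m [True, True, True, False])) x = x)
       [1..<8] \<and>
     act (perm_of \<sigma>) (perm_of \<rho>) w 2 \<noteq> 2)
     (zip noncongruence_tables noncongruence_witnesses)"
  by code_simp

lemma noncongruence_table_not_congruence:
  assumes table: "(\<sigma>, \<rho>) \<in> set noncongruence_tables"
    and "stabilizer_action {1..7} (perm_of \<sigma>) (perm_of \<rho>) j H"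
  shows "\<not> congruence_subgroup H"
proof -
  interpret stabilizer_action "{1..7}" "perm_of \<sigma>" "perm_of \<rho>" j H by fact
  \<comment> \<open>Equal lengths ensure that \<open>zip\<close> drops no table.\<close>
  have "length noncongruence_tables = length noncongruence_witnesses"
    by (simp add: noncongruence_tables_def noncongruence_witnesses_def)
  then have "set noncongruence_tables = fst ` set (zip noncongruence_tables noncongruence_witnesses)"
    by (metis map_fst_zip set_map)
  with table obtain m w where mw: "((\<sigma>, \<rho>), (m, w)) \<in> set (zip noncongruence_tables noncongruence_witnesses)"
    by auto
  then have "word_mat w \<in> principal_congruence m"
    using witness_in_principal_congruence by (auto simp: list_all_iff dest!: set_zip_rightD)
  moreover have "m \<noteq> 0" "act (perm_of \<sigma>) (perm_of \<rho>) w 2 \<noteq> 2"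
    "list_all (\<lambda>x. act (perm_of \<sigma>) (perm_of \<rho>) (concat (replicate m [True, True, True, False])) x = x) [1..<8]"
    using witness_acts_nontrivially mw unfolding list_all_iff[of _ "zip _ _"] by blast+
  moreover have "x \<in> set [1..<8]" if "x \<in> {1..7}" for x :: nat
    using that by auto
  ultimately show ?thesis
    by (intro not_congruence_subgroup[of m w 2]) (auto simp only: list_all_iff, simp)
qed

text \<open>The certificate concerns the point 1 only; transitivity and normality of \<Gamma>(N)
  carry it to j.\<close>

lemma (in stabilizer_action) congruence_table_congruence:
  assumes "(N, \<sigma>, \<rho>) \<in> set congruence_tables" "j \<in> {1..length \<sigma>}"
    and stab: "\<And>w. act s r w x0 = x0 \<longleftrightarrow> act (perm_of \<sigma>) (perm_of \<rho>) w j = j"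
  shows "congruence_subgroup H"
proof -
  have cert: "certified (N, \<sigma>, \<rho>)"
    using congruence_tables_certified assms(1) unfolding list_all_iff by blast
  have "modular_table (\<sigma>, \<rho>)"
    using modular_tables assms(1) unfolding list_all_iff by force
  then interpret table: modular_action "{1..length \<sigma>}" "perm_of \<sigma>" "perm_of \<rho>" 1
    by (rule modular_action_table) (use assms(2) in simp)
  have "to_PSL2Z ` principal_congruence N \<subseteq> H"
  proof (rule image_subsetI)
    fix A assume A: "A \<in> principal_congruence N"
    then have "A \<in> carrier SL2Z" unfolding principal_congruence_def by blast
    then obtain w where w: "A = word_mat w" using range_word_mat by blast
    then have "act (perm_of \<sigma>) (perm_of \<rho>) w j = j"
      using table.principal_congruence_acts_trivially[OF certified_fixes[OF cert]] A assms(2) by blast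
    then show "to_PSL2Z A \<in> H"
      by (simp add: w to_PSL2Z_word_mat word_in_H stab)
  qed
  moreover have "N \<ge> 1" using cert by (simp add: certified_def)
  ultimately show ?thesis
    unfolding congruence_subgroup_def using subgroup_H by blast
qed

section \<open>The four given homomorphisms\<close>

lemma stabilizer_action_hom_determined_by:
  assumes perm: "s permutes {1..7}" "r permutes {1..7}"
    and agree: "\<And>x. x \<in> {1..7} \<Longrightarrow> s x = perm_of \<sigma> x" "\<And>x. x \<in> {1..7} \<Longrightarrow> r x = perm_of \<rho> x"
    and table: "modular_table (\<sigma>, \<rho>)" "length \<sigma> = 7" and j: "j \<in> {1..7}"
  shows "stabilizer_action {1..7} (perm_of \<sigma>) (perm_of \<rho>) j (stab_preimage (hom_determined_by s r) j)"
proof -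
  interpret tab: modular_action "{1..7}" "perm_of \<sigma>" "perm_of \<rho>" j
    using modular_action_table[OF table(1)] table(2) j by simp
  interpret S7: group "sym_group 7" by (rule sym_group_is_group)
  \<comment> \<open>Relations in \<open>sym_group 7\<close> are equations of functions on all
    naturals, so points outside \<open>{1..7}\<close>, fixed by both permutations, are
    included.\<close>
  have "s (s x) = x \<and> r (r (r x)) = x" for x
  proof (cases "x \<in> {1..7}")
    case True
    then show ?thesis
      using tab.s_s tab.r_r_r tab.s_in tab.r_in agree by metis
  next
    case False
    with perm show ?thesis by (metis permutes_not_in)
  qed
  then interpret modular_pair "sym_group 7" s r
    by unfold_locales (auto simp: sym_group_carrier sym_group_mult sym_group_one perm simp del: One_nat_def)
  define \<phi> where "\<phi> = hom_determined_by s r"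
  have \<phi>: "\<phi> \<in> hom PSL2Z (sym_group 7)" "\<phi> gen_S = s" "\<phi> gen_R = r"
    using theI'[OF ex1_hom_PSL2Z] unfolding \<phi>_def hom_determined_by_def by blast+
  interpret group_hom PSL2Z "sym_group 7" \<phi>
    by unfold_locales (rule \<phi>(1))
  have "wprod (sym_group 7) s r w = act s r w" for w
    by (induction w) (auto simp: sym_group_mult sym_group_one)
  then have word: "\<phi> (word_PSL w) = act s r w" for w
    using hom_wprod[OF gen_closed] \<phi>(2,3) by simp
  have "act s r w j = act (perm_of \<sigma>) (perm_of \<rho>) w j" for w
    by (rule act_cong[of "{1..7}"]) (use tab.s_in tab.r_in agree j in auto)
  \<comment> \<open>Lying in the image is automatic for a value of \<phi>, so stabilizing j in the
    image group is just fixing j.\<close>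
  moreover have "stab_preimage \<phi> j = {g \<in> carrier PSL2Z. \<phi> g j = j}"
    by (auto simp: stab_preimage_def stabilizer_def)
  ultimately show ?thesis
    unfolding \<phi>_def[symmetric] by unfold_locales (simp_all add: word)
qed

lemma cycles_eq_perm_of:
  assumes "x \<in> {1..7}"
  shows "(cycle_of_list [1,2] \<circ> cycle_of_list [3,4] \<circ> cycle_of_list [5,6]) x = perm_of [2, 1, 4, 3, 6, 5, 7] x"
    and "(cycle_of_list [1,2] \<circ> cycle_of_list [3,4] \<circ> cycle_of_list [6,7]) x = perm_of [2, 1, 4, 3, 5, 7, 6] x"
    and "(cycle_of_list [2,3,5] \<circ> cycle_of_list [4,6,7]) x = perm_of [1, 3, 5, 6, 2, 7, 4] x"
    and "(cycle_of_list [2,3,5] \<circ> cycle_of_list [7,6,4]) x = perm_of [1, 3, 5, 7, 2, 4, 6] x"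
    and "(cycle_of_list [2,5,3] \<circ> cycle_of_list [4,6,7]) x = perm_of [1, 5, 2, 6, 3, 7, 4] x"
proof -
  from assms have "x = 1 \<or> x = 2 \<or> x = 3 \<or> x = 4 \<or> x = 5 \<or> x = 6 \<or> x = 7" by auto
  then show "(cycle_of_list [1,2] \<circ> cycle_of_list [3,4] \<circ> cycle_of_list [5,6]) x = perm_of [2, 1, 4, 3, 6, 5, 7] x"
    and "(cycle_of_list [1,2] \<circ> cycle_of_list [3,4] \<circ> cycle_of_list [6,7]) x = perm_of [2, 1, 4, 3, 5, 7, 6] x"
    and "(cycle_of_list [2,3,5] \<circ> cycle_of_list [4,6,7]) x = perm_of [1, 3, 5, 6, 2, 7, 4] x"
    and "(cycle_of_list [2,3,5] \<circ> cycle_of_list [7,6,4]) x = perm_of [1, 3, 5, 7, 2, 4, 6] x"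
    and "(cycle_of_list [2,5,3] \<circ> cycle_of_list [4,6,7]) x = perm_of [1, 5, 2, 6, 3, 7, 4] x"
    by (elim disjE; simp add: perm_of_def transpose_def)+
qed

lemma cycles_permute:
  "cycle_of_list [1,2] \<circ> cycle_of_list [3,4] \<circ> cycle_of_list [5,6] permutes {1..7::nat}"
  "cycle_of_list [1,2] \<circ> cycle_of_list [3,4] \<circ> cycle_of_list [6,7] permutes {1..7::nat}"
  "cycle_of_list [2,3,5] \<circ> cycle_of_list [4,6,7] permutes {1..7::nat}"
  "cycle_of_list [2,3,5] \<circ> cycle_of_list [7,6,4] permutes {1..7::nat}"
  "cycle_of_list [2,5,3] \<circ> cycle_of_list [4,6,7] permutes {1..7::nat}"
  by (intro permutes_compose permutes_subset[OF cycle_permutes]; simp)+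

lemma stabilizer_action_phi:
  assumes "(\<phi>, \<sigma>, \<rho>) \<in> set (zip [phi1, phi2, phi3, phi4] noncongruence_tables)" "j \<in> {1..7}"
  shows "stabilizer_action {1..7} (perm_of \<sigma>) (perm_of \<rho>) j (stab_preimage \<phi> j)"
proof -
  have "(\<sigma>, \<rho>) \<in> set noncongruence_tables" using assms(1) by (rule set_zip_rightD)
  then have table: "modular_table (\<sigma>, \<rho>)"
    using modular_tables unfolding list_all_iff by auto
  from assms(1) consider
      "\<phi> = phi1" "\<sigma> = [2, 1, 4, 3, 6, 5, 7]" "\<rho> = [1, 3, 5, 6, 2, 7, 4]"
    | "\<phi> = phi2" "\<sigma> = [2, 1, 4, 3, 6, 5, 7]" "\<rho> = [1, 3, 5, 7, 2, 4, 6]"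
    | "\<phi> = phi3" "\<sigma> = [2, 1, 4, 3, 5, 7, 6]" "\<rho> = [1, 3, 5, 6, 2, 7, 4]"
    | "\<phi> = phi4" "\<sigma> = [2, 1, 4, 3, 5, 7, 6]" "\<rho> = [1, 5, 2, 6, 3, 7, 4]"
    by (auto simp: noncongruence_tables_def)
  then show ?thesis
  proof cases
    case 1
    show ?thesis
      unfolding 1 phi1_def
      by (rule stabilizer_action_hom_determined_by[OF cycles_permute(1,3)
            cycles_eq_perm_of(1,3) table[unfolded 1] _ assms(2)]) simp_all
  next
    case 2
    show ?thesis
      unfolding 2 phi2_def
      by (rule stabilizer_action_hom_determined_by[OF cycles_permute(1,4)
            cycles_eq_perm_of(1,4) table[unfolded 2] _ assms(2)]) simp_all
  next
    case 3
    show ?thesis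
      unfolding 3 phi3_def
      by (rule stabilizer_action_hom_determined_by[OF cycles_permute(2,3)
            cycles_eq_perm_of(2,3) table[unfolded 3] _ assms(2)]) simp_all
  next
    case 4
    show ?thesis
      unfolding 4 phi4_def
      by (rule stabilizer_action_hom_determined_by[OF cycles_permute(2,5)
            cycles_eq_perm_of(2,5) table[unfolded 4] _ assms(2)]) simp_all
  qed
qed

text \<open>Because the classification keeps track of the base point j, the noncongruence case gives
  equality with \<open>stab_preimage \<phi> j\<close> and not just conjugacy: both subgroups contain
  the same words.\<close>

lemma small_index_cases:
  assumes H: "subgroup H PSL2Z" and fin: "finite (rcosets\<^bsub>PSL2Z\<^esub> H)"
    and le: "card (rcosets\<^bsub>PSL2Z\<^esub> H) \<le> 7"
  obtains "congruence_subgroup H"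
  | \<phi> j where "card (rcosets\<^bsub>PSL2Z\<^esub> H) = 7" "\<phi> \<in> {phi1, phi2, phi3, phi4}" "j \<in> {1..7}"
      "H = stab_preimage \<phi> j"
proof -
  interpret stabilizer_action "rcosets\<^bsub>PSL2Z\<^esub> H" "\<lambda>c. c #>\<^bsub>PSL2Z\<^esub> inv\<^bsub>PSL2Z\<^esub> gen_S"
    "\<lambda>c. c #>\<^bsub>PSL2Z\<^esub> inv\<^bsub>PSL2Z\<^esub> gen_R" H H
    by (rule coset_action[OF H])
  obtain \<sigma> \<rho> j where table: "(\<sigma>, \<rho>) \<in> set (noncongruence_tables @ map snd congruence_tables)"
    and len: "length \<sigma> = card (rcosets\<^bsub>PSL2Z\<^esub> H)" "j \<in> {1..card (rcosets\<^bsub>PSL2Z\<^esub> H)}"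
    and stab: "\<And>w. act (\<lambda>c. c #>\<^bsub>PSL2Z\<^esub> inv\<^bsub>PSL2Z\<^esub> gen_S) (\<lambda>c. c #>\<^bsub>PSL2Z\<^esub> inv\<^bsub>PSL2Z\<^esub> gen_R) w H = H \<longleftrightarrow>
      act (perm_of \<sigma>) (perm_of \<rho>) w j = j"
    using classification[OF fin le] by blast
  show thesis
  proof (cases "(\<sigma>, \<rho>) \<in> set noncongruence_tables")
    case True
    have "set noncongruence_tables = snd ` set (zip [phi1, phi2, phi3, phi4] noncongruence_tables)"
      by (simp add: noncongruence_tables_def)
    with True obtain \<phi> where \<phi>: "(\<phi>, \<sigma>, \<rho>) \<in> set (zip [phi1, phi2, phi3, phi4] noncongruence_tables)"
      by auto
    have 7: "card (rcosets\<^bsub>PSL2Z\<^esub> H) = 7"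
      using True len(1) by (auto simp: noncongruence_tables_def)
    with len(2) have j: "j \<in> {1..7}" by simp
    interpret \<phi>: stabilizer_action "{1..7}" "perm_of \<sigma>" "perm_of \<rho>" j "stab_preimage \<phi> j"
      by (rule stabilizer_action_phi[OF \<phi> j])
    have "word_PSL w \<in> H \<longleftrightarrow> word_PSL w \<in> stab_preimage \<phi> j" for w
      by (simp only: word_in_H \<phi>.word_in_H stab)
    then have "H = stab_preimage \<phi> j"
      using H_closed \<phi>.H_closed unfolding carrier_PSL2Z_eq_range by blast
    then show thesis
      using that(2)[OF 7 _ j] set_zip_leftD[OF \<phi>] by simp
  next
    case False
    with table obtain N where "(N, \<sigma>, \<rho>) \<in> set congruence_tables" by auto
    then show thesis
      using that(1) congruence_table_congruence[OF _ _ stab] len by simp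
  qed
qed

theorem theorem2p1:
  shows "(\<forall>H. subgroup H PSL2Z \<and> finite (rcosets\<^bsub>PSL2Z\<^esub> H) \<and> card (rcosets\<^bsub>PSL2Z\<^esub> H) < 7
             \<longrightarrow> congruence_subgroup H)
       \<and> {H. noncongruence_subgroup H \<and> card (rcosets\<^bsub>PSL2Z\<^esub> H) = 7}
           = (\<Union>j\<in>{1..7}. {stab_preimage phi1 j, stab_preimage phi2 j,
                            stab_preimage phi3 j, stab_preimage phi4 j})"
proof (intro conjI allI impI equalityI subsetI)
  fix H assume H: "subgroup H PSL2Z \<and> finite (rcosets\<^bsub>PSL2Z\<^esub> H) \<and> card (rcosets\<^bsub>PSL2Z\<^esub> H) < 7"
  then have "subgroup H PSL2Z" "finite (rcosets\<^bsub>PSL2Z\<^esub> H)" "card (rcosets\<^bsub>PSL2Z\<^esub> H) \<le> 7" by simp_all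
  then show "congruence_subgroup H" by (rule small_index_cases) (use H in simp_all)
next
  fix H assume H: "H \<in> {H. noncongruence_subgroup H \<and> card (rcosets\<^bsub>PSL2Z\<^esub> H) = 7}"
  \<comment> \<open>Finiteness follows from \<open>card\<close> = 7, as \<open>card\<close> of an
    infinite set is 0.\<close>
  then have "subgroup H PSL2Z" "finite (rcosets\<^bsub>PSL2Z\<^esub> H)" "card (rcosets\<^bsub>PSL2Z\<^esub> H) \<le> 7"
    by (auto simp: noncongruence_subgroup_def intro: card_ge_0_finite)
  then show "H \<in> (\<Union>j\<in>{1..7}. {stab_preimage phi1 j, stab_preimage phi2 j,
      stab_preimage phi3 j, stab_preimage phi4 j})"
    by (rule small_index_cases) (use H in \<open>auto simp: noncongruence_subgroup_def\<close>)
next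
  fix H assume "H \<in> (\<Union>j\<in>{1..7}. {stab_preimage phi1 j, stab_preimage phi2 j,
      stab_preimage phi3 j, stab_preimage phi4 j})"
  then obtain \<phi> j where "\<phi> \<in> set [phi1, phi2, phi3, phi4]" and j: "j \<in> {1..7}"
    and H: "H = stab_preimage \<phi> j" unfolding list.set by blast
  moreover have "set [phi1, phi2, phi3, phi4] = fst ` set (zip [phi1, phi2, phi3, phi4] noncongruence_tables)"
    by (simp add: noncongruence_tables_def)
  ultimately have "\<phi> \<in> fst ` set (zip [phi1, phi2, phi3, phi4] noncongruence_tables)"
    by (simp only:)
  then obtain \<sigma> \<rho> where \<phi>: "(\<phi>, \<sigma>, \<rho>) \<in> set (zip [phi1, phi2, phi3, phi4] noncongruence_tables)"
    by (elim imageE) (metis prod.collapse)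
  interpret stabilizer_action "{1..7}" "perm_of \<sigma>" "perm_of \<rho>" j H
    unfolding H by (rule stabilizer_action_phi[OF \<phi> j])
  have "\<not> congruence_subgroup H"
    by (rule noncongruence_table_not_congruence[OF set_zip_rightD[OF \<phi>] stabilizer_action_axioms])
  then show "H \<in> {H. noncongruence_subgroup H \<and> card (rcosets\<^bsub>PSL2Z\<^esub> H) = 7}"
    using subgroup_H card_rcosets by (simp add: noncongruence_subgroup_def)
qed

end
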